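(* Suppose that for every non-$\alpha$-acyclic (self-join-free) Boolean conjunctive query there is no linear-time algorithm that counts its solutions. Then for every (self-join-free) sum-product query with negation over the counting ring $(\mathbb{Z},+,\times,0,1)$ that is not signed-acyclic there is no linear-time algorithm.
   Context: Write $[n]=\{1,\dots,n\}$. A Boolean conjunctive query with hypergraph $([n],\mathcal{E})$ is $Q()\leftarrow\bigwedge_{K\in\mathcal{E}}R_K(\mathbf{x}_K)$; counting its solutions on a database $\mathcal{D}$ means computing the number of valuations of the variables $x_1,\dots,x_n$ that satisfy all atoms. It is (non-)$\alpha$-acyclic according to its hypergraph. A sum-product query with negation over a commutative semiring $(\boldsymbol{D},\oplus,\otimes,\mathbf{0},\mathbf{1})$ is an expression without free variables $\varphi()=\bigoplus_{\mathbf{x}_{[n]}}\ \bigotimes_{K\in\mathcal{E}^+}R_K(\mathbf{x}_K)\otimes\bigotimes_{N\in\mathcal{E}^-}\overline{R}_N(\mathbf{x}_N)$, where $\mathcal{E}^+,\mathcal{E}^-$ are collections of subsets of $[n]$ with $\bigcup_{K\in\mathcal{E}^+}K=[n]$ (safety) and the sum ranges over all valuations of the variables in their domains. A positive factor $R_K$ is given as a table of tuples with semiring values, tuples not in the table having value $\mathbf{0}$; a negative factor $\overline{R}_N$ is given as a table of tuples with semiring values and a default constant $\mathbf{c}_N\neq\mathbf{0}$ that is the value of every tuple not in the table. An algorithm for $\varphi$ computes $\varphi()$ from the input database $\mathcal{D}$ (tables and default constants). Self-join-free means each relation/factor name appears at most once. Queries are fixed, and linear time means time $O(|\mathcal{D}|)$,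 $|\mathcal{D}|$ being the total size of the tables, on a random-access machine with $O(\log n)$-bit words. A hypergraph $([n],\mathcal{E})$ is $\alpha$-acyclic if there is a tree $\mathcal{T}$ and a bijection $\chi$ from $\mathcal{E}$ to the nodes of $\mathcal{T}$ such that for every $v\in[n]$ the nodes $\{\chi(K): v\in K\in\mathcal{E}\}$ induce a connected subgraph. $\varphi$ is signed-acyclic if $([n],\mathcal{E}^+\cup\mathcal{E}')$ is $\alpha$-acyclic for every $\mathcal{E}'\subseteq\mathcal{E}^-$. *)

theory Defs
  imports Complex_Main "HOL-Library.FuncSet" "HOL-Library.Log_Nat"
begin

section \<open>Hypergraphs\<close>

text \<open>
  A hypergraph on the vertex set \<open>{1..n}\<close> is given by its set of hyperedges. Graphs are given by
  a vertex set and a set of two-element sets of vertices.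
\<close>

definition induces_connected :: "'v set set \<Rightarrow> 'v set \<Rightarrow> bool" where
  "induces_connected F S \<longleftrightarrow>
     (\<forall>u\<in>S. \<forall>v\<in>S. (u, v) \<in> {(a, b). a \<in> S \<and> b \<in> S \<and> {a, b} \<in> F}\<^sup>*)"

definition graph_cycle :: "'v set set \<Rightarrow> 'v list \<Rightarrow> bool" where
  "graph_cycle F p \<longleftrightarrow>
     3 \<le> length p \<and> distinct p \<and> (\<forall>i<length p. {p ! i, p ! (Suc i mod length p)} \<in> F)"

text \<open>The graph without vertices counts as a tree, so that the empty hypergraph is acyclic.\<close>

definition is_tree :: "'v set \<Rightarrow> 'v set set \<Rightarrow> bool" where
  "is_tree V F \<longleftrightarrow>
     finite V \<and> (\<forall>e\<in>F. e \<subseteq> V \<and> card e = 2) \<and> induces_connected F V \<and> (\<nexists>p. graph_cycle F p)"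

definition alpha_acyclic :: "nat \<Rightarrow> nat set set \<Rightarrow> bool" where
  "alpha_acyclic n E \<longleftrightarrow>
     (\<exists>(V :: nat set) F \<chi>. is_tree V F \<and> bij_betw \<chi> E V \<and>
        (\<forall>v\<in>{1..n}. induces_connected F (\<chi> ` {K \<in> E. v \<in> K})))"

definition signed_acyclic :: "nat \<Rightarrow> nat set set \<Rightarrow> nat set set \<Rightarrow> bool" where
  "signed_acyclic n Ep En \<longleftrightarrow> (\<forall>E'\<subseteq>En. alpha_acyclic n (Ep \<union> E'))"

section \<open>Valuations, queries and databases\<close>

text \<open>
  Domain values are natural numbers, and valuations of \<open>x\<^sub>1, \<dots>, x\<^sub>n\<close> are extensional functions on
  \<open>{1..n}\<close>. The tuple of values of the variables in \<open>K\<close> lists them by increasing index.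
\<close>

definition valuations :: "nat \<Rightarrow> (nat \<Rightarrow> nat) set" where
  "valuations n = {1..n} \<rightarrow>\<^sub>E UNIV"

definition tuple_at :: "(nat \<Rightarrow> nat) \<Rightarrow> nat set \<Rightarrow> nat list" where
  "tuple_at x K = map x (sorted_list_of_set K)"

text \<open>
  Atoms and factors are named by their variable sets, so all queries are self-join-free. In a
  sum-product query, the positive and the negative factor of \<open>K\<close> are distinct if \<open>K\<close> is in both
  edge sets.
\<close>

definition conjunctive_query :: "nat \<Rightarrow> nat set set \<Rightarrow> bool" where
  "conjunctive_query n E \<longleftrightarrow> E \<subseteq> Pow {1..n} \<and> \<Union>E = {1..n}"

definition sum_product_query :: "nat \<Rightarrow> nat set set \<Rightarrow> nat set set \<Rightarrow> bool" where
  "sum_product_query n Ep En \<longleftrightarrow> Ep \<subseteq> Pow {1..n} \<and> En \<subseteq> Pow {1..n} \<and> \<Union>Ep = {1..n}"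

subsection \<open>Counting for conjunctive queries\<close>

text \<open>Tables are listed in an arbitrary order without repetition.\<close>

type_synonym cq_db = "nat set \<Rightarrow> nat list list"

definition cq_db :: "nat set set \<Rightarrow> cq_db \<Rightarrow> bool" where
  "cq_db E D \<longleftrightarrow> (\<forall>K\<in>E. distinct (D K) \<and> (\<forall>t\<in>set (D K). length t = card K))"

definition cq_size :: "nat set set \<Rightarrow> cq_db \<Rightarrow> nat" where
  "cq_size E D = (\<Sum>K\<in>E. length (D K))"

definition cq_count :: "nat \<Rightarrow> nat set set \<Rightarrow> cq_db \<Rightarrow> nat" where
  "cq_count n E D = card {x \<in> valuations n. \<forall>K\<in>E. tuple_at x K \<in> set (D K)}"

subsection \<open>Sum-product queries with negation\<close>

type_synonym 'a factor_table = "(nat list \<times> 'a) list"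

record 'a spq_db =
  pos_table :: "nat set \<Rightarrow> 'a factor_table"
  neg_table :: "nat set \<Rightarrow> 'a factor_table"
  neg_default :: "nat set \<Rightarrow> 'a"

definition factor_table :: "nat set \<Rightarrow> 'a factor_table \<Rightarrow> bool" where
  "factor_table K T \<longleftrightarrow> distinct (map fst T) \<and> (\<forall>(t, v)\<in>set T. length t = card K)"

definition spq_db :: "nat set set \<Rightarrow> nat set set \<Rightarrow> 'a::zero spq_db \<Rightarrow> bool" where
  "spq_db Ep En D \<longleftrightarrow>
     (\<forall>K\<in>Ep. factor_table K (pos_table D K)) \<and>
     (\<forall>N\<in>En. factor_table N (neg_table D N) \<and> neg_default D N \<noteq> 0)"

definition spq_size :: "nat set set \<Rightarrow> nat set set \<Rightarrow> 'a spq_db \<Rightarrow> nat" where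
  "spq_size Ep En D = (\<Sum>K\<in>Ep. length (pos_table D K)) + (\<Sum>N\<in>En. length (neg_table D N))"

definition factor_value :: "'a \<Rightarrow> 'a factor_table \<Rightarrow> nat list \<Rightarrow> 'a" where
  "factor_value d T t = (case map_of T t of None \<Rightarrow> d | Some v \<Rightarrow> v)"

definition spq_summand ::
    "nat set set \<Rightarrow> nat set set \<Rightarrow> 'a::comm_semiring_1 spq_db \<Rightarrow> (nat \<Rightarrow> nat) \<Rightarrow> 'a" where
  "spq_summand Ep En D x =
     (\<Prod>K\<in>Ep. factor_value 0 (pos_table D K) (tuple_at x K)) *
     (\<Prod>N\<in>En. factor_value (neg_default D N) (neg_table D N) (tuple_at x N))"

text \<open>
  The sum over all valuations is written over those with non-zero summand, of which there are
  only finitely many because of safety.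
\<close>

definition spq_value ::
    "nat \<Rightarrow> nat set set \<Rightarrow> nat set set \<Rightarrow> 'a::comm_semiring_1 spq_db \<Rightarrow> 'a" where
  "spq_value n Ep En D =
     (\<Sum>x | x \<in> valuations n \<and> spq_summand Ep En D x \<noteq> 0. spq_summand Ep En D x)"

section \<open>Random-access machine with bounded words\<close>

text \<open>
  The operands \<open>r\<close>, \<open>a\<close>, \<open>b\<close> of the instructions are register numbers, and \<open>l\<close> is a position in
  the program.
\<close>

datatype arith_op = Plus | Minus | Times | Divide | Modulo | BitAnd | BitOr | BitXor

datatype instr =
    Const nat int                (* r := c *)
  | Arith arith_op nat nat nat   (* r := a op b *)
  | Load nat nat                 (* r := mem[a] *)
  | Store nat nat                (* mem[a] := b *)
  | Jump nat                     (* goto l *)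
  | JumpLe nat nat nat           (* if a <= b goto l *)

fun arith :: "arith_op \<Rightarrow> int \<Rightarrow> int \<Rightarrow> int" where
  "arith Plus x y = x + y"
| "arith Minus x y = x - y"
| "arith Times x y = x * y"
| "arith Divide x y = x div y"
| "arith Modulo x y = x mod y"
| "arith BitAnd x y = and x y"
| "arith BitOr x y = or x y"
| "arith BitXor x y = xor x y"

record config =
  pc :: nat
  reg :: "nat \<Rightarrow> int"
  mem :: "nat \<Rightarrow> int"

text \<open>A word consists of a sign and \<open>w\<close> further bits.\<close>

definition words :: "nat \<Rightarrow> int set" where
  "words w = {- (2 ^ w) ..< 2 ^ w}"

text \<open>
  A step is undefined (and the computation fails) if a register would receive a value that is not
  a word or if a negative address is used. Memory cells are only filled from registers.
\<close>

definition set_reg :: "nat \<Rightarrow> nat \<Rightarrow> int \<Rightarrow> config \<Rightarrow> config option" where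
  "set_reg w r v s =
     (if v \<in> words w then Some (s\<lparr>pc := Suc (pc s), reg := (reg s)(r := v)\<rparr>) else None)"

fun exec_instr :: "nat \<Rightarrow> instr \<Rightarrow> config \<Rightarrow> config option" where
  "exec_instr w (Const r c) s = set_reg w r c s"
| "exec_instr w (Arith f r a b) s = set_reg w r (arith f (reg s a) (reg s b)) s"
| "exec_instr w (Load r a) s =
     (if reg s a < 0 then None else set_reg w r (mem s (nat (reg s a))) s)"
| "exec_instr w (Store a b) s =
     (if reg s a < 0 then None
      else Some (s\<lparr>pc := Suc (pc s), mem := (mem s)(nat (reg s a) := reg s b)\<rparr>))"
| "exec_instr w (Jump l) s = Some (s\<lparr>pc := l\<rparr>)"
| "exec_instr w (JumpLe a b l) s =
     Some (s\<lparr>pc := (if reg s a \<le> reg s b then l else Suc (pc s))\<rparr>)"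

definition halted :: "instr list \<Rightarrow> config \<Rightarrow> bool" where
  "halted P s \<longleftrightarrow> length P \<le> pc s"

definition step :: "nat \<Rightarrow> instr list \<Rightarrow> config \<Rightarrow> config option" where
  "step w P s = (if halted P s then None else exec_instr w (P ! pc s) s)"

fun steps :: "nat \<Rightarrow> instr list \<Rightarrow> nat \<Rightarrow> config \<Rightarrow> config option" where
  "steps w P 0 s = Some s"
| "steps w P (Suc t) s = Option.bind (step w P s) (steps w P t)"

text \<open>The input is in memory from address \<open>0\<close> on, and its length is in register \<open>0\<close>.\<close>

definition initial :: "int list \<Rightarrow> config" where
  "initial ws =
     \<lparr>pc = 0,
      reg = (\<lambda>r. if r = 0 then int (length ws) else 0),
      mem = (\<lambda>i. if i < length ws then ws ! i else 0)\<rparr>"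

text \<open>The output is in register \<open>0\<close>.\<close>

definition computes_in :: "nat \<Rightarrow> instr list \<Rightarrow> int list \<Rightarrow> nat \<Rightarrow> int \<Rightarrow> bool" where
  "computes_in w P ws t out \<longleftrightarrow>
     (\<exists>s. steps w P t (initial ws) = Some s \<and> halted P s \<and> reg s 0 = out)"

section \<open>Linear-time algorithms\<close>

text \<open>
  On instances \<open>I\<close> of size \<open>m\<close>, words have \<open>O(log m)\<close> bits. The input may use words of
  \<open>a \<sqdot> log m\<close> bits for any constant \<open>a\<close>; the constants for the words of the machine and
  for the running time may depend on \<open>a\<close>, the program may not. The shifts of \<open>m\<close> by \<open>2\<close> and \<open>1\<close>
  allow for the smallest instances.
\<close>

definition log_bits :: "nat \<Rightarrow> nat" where
  "log_bits m = ceillog2 (m + 2)"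

definition linear_time_program ::
    "'i set \<Rightarrow> ('i \<Rightarrow> nat) \<Rightarrow> ('i \<Rightarrow> int list) \<Rightarrow> ('i \<Rightarrow> int) \<Rightarrow> instr list \<Rightarrow> bool" where
  "linear_time_program Inst sz enc f P \<longleftrightarrow>
     (\<forall>a. \<exists>k c. \<forall>I\<in>Inst. set (enc I) \<subseteq> words (a * log_bits (sz I)) \<longrightarrow>
        (\<exists>t \<le> c * (sz I + 1). computes_in (k * log_bits (sz I)) P (enc I) t (f I)))"

text \<open>
  The tables are given to the machine one after the other, each preceded by its number of rows
  (and by the default constant, for a negative factor). As queries are fixed, the order of the
  tables is an immaterial convention; it is existentially quantified.
\<close>

definition encode_cq_db :: "nat set list \<Rightarrow> cq_db \<Rightarrow> int list" where
  "encode_cq_db Ks D = concat (map (\<lambda>K. int (length (D K)) # concat (map (map int) (D K))) Ks)"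

definition encode_rows :: "int factor_table \<Rightarrow> int list" where
  "encode_rows T = concat (map (\<lambda>(t, v). map int t @ [v]) T)"

definition encode_spq_db :: "nat set list \<Rightarrow> nat set list \<Rightarrow> int spq_db \<Rightarrow> int list" where
  "encode_spq_db Ks Ns D =
     concat (map (\<lambda>K. int (length (pos_table D K)) # encode_rows (pos_table D K)) Ks) @
     concat (map (\<lambda>N. int (length (neg_table D N)) # neg_default D N # encode_rows (neg_table D N)) Ns)"

definition linear_time_counting :: "nat \<Rightarrow> nat set set \<Rightarrow> bool" where
  "linear_time_counting n E \<longleftrightarrow>
     (\<exists>Ks P. distinct Ks \<and> set Ks = E \<and>
        linear_time_program {D. cq_db E D} (cq_size E) (encode_cq_db Ks)
          (\<lambda>D. int (cq_count n E D)) P)"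

definition linear_time_int_spq :: "nat \<Rightarrow> nat set set \<Rightarrow> nat set set \<Rightarrow> bool" where
  "linear_time_int_spq n Ep En \<longleftrightarrow>
     (\<exists>Ks Ns P. distinct Ks \<and> set Ks = Ep \<and> distinct Ns \<and> set Ns = En \<and>
        linear_time_program {D. spq_db Ep En D} (spq_size Ep En) (encode_spq_db Ks Ns)
          (spq_value n Ep En) P)"

end

theory Submission
  imports Defs
begin

text \<open>
  Let \<open>E'\<close> be a set of negative edges such that \<open>Ep \<union> E'\<close> is not \<open>\<alpha>\<close>-acyclic. Given a database for the
  conjunctive query on \<open>Ep \<union> E'\<close>, give every listed tuple the value \<open>1\<close>, and take as default constant a
  number \<open>M\<close> greater than the count for the negative factors in \<open>E'\<close>, while the other negative
  factors become constant \<open>1\<close>. A valuation that satisfies all atoms contributes \<open>1\<close>, every other one a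
  multiple of \<open>M\<close>, so the count is the value of the sum-product query modulo \<open>M\<close>. By safety,
  \<open>M = (L + 2) ^ (card Ep + 1)\<close> suffices for an input of length \<open>L\<close>, and it has \<open>O(log m)\<close> bits.

  On the machine, a prologue that only uses registers unknown to the given program writes the new
  input behind the old one and shifts the memory down; then the relocated program runs; finally its
  output is reduced modulo \<open>M\<close>.
\<close>

section \<open>Structured programs\<close>

text \<open>Jump targets are absolute positions, so the added code is written with structured loops
  and verified by Hoare rules.\<close>

datatype com = Block "instr list" | Seq com com | While nat nat com

fun csize :: "com \<Rightarrow> nat" where
  "csize (Block is) = length is"
| "csize (Seq c d) = csize c + csize d"
| "csize (While a b c) = csize c + 2"

text \<open>\<open>p\<close> is the position of the first instruction of the code. A loop needs two
  instructions besides its body: the test with its exit and the jump back.\<close>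

fun compile :: "nat \<Rightarrow> com \<Rightarrow> instr list" where
  "compile p (Block is) = is"
| "compile p (Seq c d) = compile p c @ compile (p + csize c) d"
| "compile p (While a b c) = JumpLe b a (p + csize c + 2) # compile (Suc p) c @ [Jump p]"

lemma length_compile [simp]: "length (compile p c) = csize c"
  by (induction c arbitrary: p) auto

type_synonym assertion = "(nat \<Rightarrow> int) \<Rightarrow> (nat \<Rightarrow> int) \<Rightarrow> bool"

text \<open>Total correctness with a bound on the number of steps. A step that overflows a word is
  undefined, so the triple also excludes overflow. The arbitrary \<open>pre\<close> and
  \<open>post\<close> make it independent of the place of the code, which lets triples
  compose.\<close>

definition hoare :: "nat \<Rightarrow> assertion \<Rightarrow> com \<Rightarrow> nat \<Rightarrow> assertion \<Rightarrow> bool" where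
  "hoare w A c T B \<longleftrightarrow> (\<forall>R m pre post. A R m \<longrightarrow> (\<exists>t\<le>T. \<exists>R' m'. B R' m' \<and>
     steps w (pre @ compile (length pre) c @ post) t \<lparr>pc = length pre, reg = R, mem = m\<rparr> =
       Some \<lparr>pc = length pre + csize c, reg = R', mem = m'\<rparr>))"

text \<open>Straight-line code is handled by computing its weakest precondition, including the
  conditions that results are words and addresses are non-negative. Jumps arise from loops only and
  are excluded.\<close>

fun wp :: "nat \<Rightarrow> instr list \<Rightarrow> assertion \<Rightarrow> assertion" where
  "wp w [] B R m = B R m"
| "wp w (Const r c # is) B R m = (c \<in> words w \<and> wp w is B (R(r := c)) m)"
| "wp w (Arith f r a b # is) B R m =
     (arith f (R a) (R b) \<in> words w \<and> wp w is B (R(r := arith f (R a) (R b))) m)"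
| "wp w (Load r a # is) B R m =
     (0 \<le> R a \<and> m (nat (R a)) \<in> words w \<and> wp w is B (R(r := m (nat (R a)))) m)"
| "wp w (Store a b # is) B R m = (0 \<le> R a \<and> wp w is B R (m(nat (R a) := R b)))"
| "wp w (Jump l # is) B R m = False"
| "wp w (JumpLe a b l # is) B R m = False"

lemma steps_add: "steps w P (t + u) s = Option.bind (steps w P t s) (steps w P u)"
proof (induction t arbitrary: s)
  case (Suc t)
  show ?case
    by (cases "step w P s") (simp_all add: Suc)
qed simp

lemma steps_trans:
  "steps w P t s = Some s' \<Longrightarrow> steps w P u s' = Some s'' \<Longrightarrow> steps w P (t + u) s = Some s''"
  by (simp add: steps_add)

lemma step_nth:
  "step w (pre @ i # post) \<lparr>pc = length pre, reg = R, mem = m\<rparr> =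
     exec_instr w i \<lparr>pc = length pre, reg = R, mem = m\<rparr>"
  by (simp add: step_def halted_def)

lemma wp_steps:
  "wp w is B R m \<Longrightarrow> \<exists>R' m'. B R' m' \<and>
     steps w (pre @ is @ post) (length is) \<lparr>pc = length pre, reg = R, mem = m\<rparr> =
       Some \<lparr>pc = length pre + length is, reg = R', mem = m'\<rparr>"
proof (induction w "is" B R m arbitrary: pre rule: wp.induct)
  case (2 w r c "is" B R m)
  then show ?case
    using "2.IH"[of "pre @ [Const r c]"] by (auto simp: step_nth set_reg_def fun_upd_def)
next
  case (3 w f r a b "is" B R m)
  then show ?case
    using "3.IH"[of "pre @ [Arith f r a b]"] by (auto simp: step_nth set_reg_def fun_upd_def)
next
  case (4 w r a "is" B R m)
  then show ?case
    using "4.IH"[of "pre @ [Load r a]"] by (auto simp: step_nth set_reg_def fun_upd_def)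
next
  case (5 w a b "is" B R m)
  then show ?case
    using "5.IH"[of "pre @ [Store a b]"] by (auto simp: step_nth set_reg_def fun_upd_def)
qed auto

lemma hoare_Block:
  assumes "\<And>R m. A R m \<Longrightarrow> wp w is B R m" and "length is \<le> T"
  shows "hoare w A (Block is) T B"
  unfolding hoare_def compile.simps csize.simps
  using assms wp_steps by meson

lemma hoare_Seq:
  assumes "hoare w A c T B" and "hoare w B d U C"
  shows "hoare w A (Seq c d) (T + U) C"
  unfolding hoare_def
proof (intro allI impI)
  fix R m and pre post :: "instr list"
  assume "A R m"
  then obtain t R' m' where t: "t \<le> T" "B R' m'"
    "steps w (pre @ compile (length pre) c @ compile (length pre + csize c) d @ post) t
       \<lparr>pc = length pre, reg = R, mem = m\<rparr> = Some \<lparr>pc = length pre + csize c, reg = R', mem = m'\<rparr>"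
    using assms(1) unfolding hoare_def by meson
  moreover obtain u R'' m'' where u: "u \<le> U" "C R'' m''"
    "steps w ((pre @ compile (length pre) c) @
         compile (length (pre @ compile (length pre) c)) d @ post) u
       \<lparr>pc = length (pre @ compile (length pre) c), reg = R', mem = m'\<rparr> =
     Some \<lparr>pc = length (pre @ compile (length pre) c) + csize d, reg = R'', mem = m''\<rparr>"
    using assms(2) t(2) unfolding hoare_def by meson
  ultimately have "steps w (pre @ compile (length pre) (Seq c d) @ post) (t + u)
       \<lparr>pc = length pre, reg = R, mem = m\<rparr> =
     Some \<lparr>pc = length pre + csize (Seq c d), reg = R'', mem = m''\<rparr>"
    by (simp add: steps_add add.assoc)
  then show "\<exists>t\<le>T + U. \<exists>R' m'. C R' m' \<and>
      steps w (pre @ compile (length pre) (Seq c d) @ post) t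
        \<lparr>pc = length pre, reg = R, mem = m\<rparr> =
      Some \<lparr>pc = length pre + csize (Seq c d), reg = R', mem = m'\<rparr>"
    using t(1) u(1,2) add_mono by blast
qed

lemma hoare_conseq:
  assumes "hoare w A c T B" and "\<And>R m. A' R m \<Longrightarrow> A R m" and "\<And>R m. B R m \<Longrightarrow> B' R m" and "T \<le> T'"
  shows "hoare w A' c T' B'"
  using assms unfolding hoare_def by (meson le_trans)

text \<open>\<open>i\<close> counts completed iterations, and the invariant determines the outcome
  of the test. An iteration costs at most \<open>T + 2\<close> steps, for the test, the body and the
  jump back; the last, failing test costs one more.\<close>

lemma hoare_While:
  assumes "\<And>i. i < N \<Longrightarrow> hoare w (I i) c T (I (Suc i))"
    and "\<And>i R m. i \<le> N \<Longrightarrow> I i R m \<Longrightarrow> R a < R b \<longleftrightarrow> i < N"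
  shows "hoare w (I 0) (While a b c) (N * (T + 2) + 1) (I N)"
proof -
  \<comment> \<open>Induction downwards from \<open>N\<close>: the claim at \<open>i\<close>
    concerns the \<open>N - i\<close> iterations still to come.\<close>
  have "hoare w (I i) (While a b c) ((N - i) * (T + 2) + 1) (I N)" if "i \<le> N" for i
    using that
  proof (induction i rule: inc_induct)
    case base
    show ?case
      unfolding hoare_def
    proof (intro allI impI)
      fix R m and pre post :: "instr list"
      assume "I N R m"
      then show "\<exists>t\<le>(N - N) * (T + 2) + 1. \<exists>R' m'. I N R' m' \<and>
          steps w (pre @ compile (length pre) (While a b c) @ post) t
            \<lparr>pc = length pre, reg = R, mem = m\<rparr> =
          Some \<lparr>pc = length pre + csize (While a b c), reg = R', mem = m'\<rparr>"
        using assms(2)[of N R m]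
        by (intro exI[of _ 1] conjI exI[of _ R] exI[of _ m]) (auto simp: step_nth)
    qed
  next
    case (step i)
    show ?case
      unfolding hoare_def
    proof (intro allI impI)
      fix R m and pre post :: "instr list"
      let ?P = "pre @ compile (length pre) (While a b c) @ post"
      let ?jmp = "JumpLe b a (length pre + csize c + 2)"
      assume I: "I i R m"
      then have "steps w ?P 1 \<lparr>pc = length pre, reg = R, mem = m\<rparr> =
          Some \<lparr>pc = Suc (length pre), reg = R, mem = m\<rparr>"
        using assms(2)[of i R m] step(2) by (auto simp: step_nth)
      moreover obtain t R' m' where t: "t \<le> T" "I (Suc i) R' m'"
        "steps w ((pre @ [?jmp]) @ compile (length (pre @ [?jmp])) c @ Jump (length pre) # post) t
           \<lparr>pc = length (pre @ [?jmp]), reg = R, mem = m\<rparr> =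
         Some \<lparr>pc = length (pre @ [?jmp]) + csize c, reg = R', mem = m'\<rparr>"
        using assms(1)[OF step(2)] I unfolding hoare_def by meson
      moreover have "steps w ?P 1 \<lparr>pc = Suc (length pre) + csize c, reg = R', mem = m'\<rparr> =
          Some \<lparr>pc = length pre, reg = R', mem = m'\<rparr>"
        using step_nth[of w "pre @ ?jmp # compile (Suc (length pre)) c" "Jump (length pre)" post R' m']
        by simp
      moreover obtain u R'' m'' where u: "u \<le> (N - Suc i) * (T + 2) + 1" "I N R'' m''"
        "steps w ?P u \<lparr>pc = length pre, reg = R', mem = m'\<rparr> =
         Some \<lparr>pc = length pre + csize (While a b c), reg = R'', mem = m''\<rparr>"
        using step.IH t(2) unfolding hoare_def by meson
      ultimately have "steps w ?P (1 + (t + (1 + u))) \<lparr>pc = length pre, reg = R, mem = m\<rparr> =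
         Some \<lparr>pc = length pre + csize (While a b c), reg = R'', mem = m''\<rparr>"
        by (intro steps_trans) (assumption | simp)+
      moreover have "N - i = Suc (N - Suc i)"
        using step(2) by simp
      then have "1 + (t + (1 + u)) \<le> (N - i) * (T + 2) + 1"
        using t(1) u(1) by simp
      ultimately show "\<exists>t\<le>(N - i) * (T + 2) + 1. \<exists>R' m'. I N R' m' \<and>
          steps w ?P t \<lparr>pc = length pre, reg = R, mem = m\<rparr> =
          Some \<lparr>pc = length pre + csize (While a b c), reg = R', mem = m'\<rparr>"
        using u(2) by blast
    qed
  qed
  from this[of 0] show ?thesis
    by simp
qed

section \<open>Relocation of programs\<close>

fun instr_regs :: "instr \<Rightarrow> nat set" where
  "instr_regs (Const r c) = {r}"
| "instr_regs (Arith f r a b) = {r, a, b}"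
| "instr_regs (Load r a) = {r, a}"
| "instr_regs (Store a b) = {a, b}"
| "instr_regs (Jump l) = {}"
| "instr_regs (JumpLe a b l) = {a, b}"

text \<open>All halting positions of a program of length \<open>N\<close> are identified with its end.\<close>

fun relocate :: "nat \<Rightarrow> nat \<Rightarrow> instr \<Rightarrow> instr" where
  "relocate p N (Jump l) = Jump (p + min l N)"
| "relocate p N (JumpLe a b l) = JumpLe a b (p + min l N)"
| "relocate p N i = i"

text \<open>\<open>s\<close> is a configuration of the given program alone, \<open>s'\<close> one of
  the composed program. The registers from \<open>z\<close> on are frozen at \<open>R0\<close>,
  which is how the modulus survives the run.\<close>

definition simulates :: "nat \<Rightarrow> nat \<Rightarrow> nat \<Rightarrow> (nat \<Rightarrow> int) \<Rightarrow> config \<Rightarrow> config \<Rightarrow> bool" where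
  "simulates z p N R0 s s' \<longleftrightarrow> pc s' = p + min (pc s) N \<and> mem s' = mem s \<and>
     (\<forall>r. reg s' r = (if r < z then reg s r else R0 r))"

lemma words_mono: "v \<le> w \<Longrightarrow> words v \<subseteq> words w"
proof -
  assume "v \<le> w"
  then have "(2::int) ^ v \<le> 2 ^ w"
    by (simp add: power_increasing)
  then show ?thesis
    by (auto simp: words_def)
qed

lemma finite_instr_regs [simp]: "finite (instr_regs i)"
  by (cases i) auto

text \<open>Instructions that only mention registers below \<open>z\<close> act alike on both sides.
  Their results do not depend on the word length, so a step defined for \<open>v\<close> bits stays
  defined for \<open>w\<close>.\<close>

lemma simulates_step:
  assumes sim: "simulates z (length pre) (length P) R0 s s'"
    and regs: "\<And>i. i \<in> set P \<Longrightarrow> instr_regs i \<subseteq> {..<z}"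
    and "v \<le> w" and step: "step v P s = Some s1"
  obtains s1' where
    "step w (pre @ map (relocate (length pre) (length P)) P @ post) s' = Some s1'"
    "simulates z (length pre) (length P) R0 s1 s1'"
proof -
  let ?P = "pre @ map (relocate (length pre) (length P)) P @ post"
  have pc: "pc s < length P" and ex: "exec_instr v (P ! pc s) s = Some s1"
    using step by (auto simp: step_def halted_def split: if_splits)
  have pc': "pc s' = length pre + pc s"
    using sim pc by (simp add: simulates_def)
  have nth: "?P ! pc s' = relocate (length pre) (length P) (P ! pc s)"
    using pc by (simp add: pc' nth_append)
  have "step w ?P s' = exec_instr w (?P ! pc s') s'"
    using pc by (simp add: step_def halted_def pc')
  then have st: "step w ?P s' = exec_instr w (relocate (length pre) (length P) (P ! pc s)) s'"
    using nth by simp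
  have r: "instr_regs (P ! pc s) \<subseteq> {..<z}"
    using regs pc by simp
  have W: "x \<in> words w" if "x \<in> words v" for x
    using words_mono[OF \<open>v \<le> w\<close>] that by blast
  have "\<exists>s1'. exec_instr w (relocate (length pre) (length P) (P ! pc s)) s' = Some s1' \<and>
      simulates z (length pre) (length P) R0 s1 s1'"
    using ex r sim pc W
    by (cases "P ! pc s")
       (auto simp: set_reg_def simulates_def min_def split: if_splits)
  then show thesis
    using that st by metis
qed

lemma simulates_steps:
  assumes "simulates z (length pre) (length P) R0 s s'"
    and regs: "\<And>i. i \<in> set P \<Longrightarrow> instr_regs i \<subseteq> {..<z}"
    and "v \<le> w" and "steps v P t s = Some s1"
  shows "\<exists>s1'. steps w (pre @ map (relocate (length pre) (length P)) P @ post) t s' = Some s1' \<and>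
    simulates z (length pre) (length P) R0 s1 s1'"
  using assms(1,4)
proof (induction t arbitrary: s s')
  case (Suc t)
  from Suc.prems(2) obtain s2 where s2: "step v P s = Some s2" "steps v P t s2 = Some s1"
    by (cases "step v P s") auto
  obtain s2' where "step w (pre @ map (relocate (length pre) (length P)) P @ post) s' = Some s2'"
    "simulates z (length pre) (length P) R0 s2 s2'"
    using simulates_step[OF Suc.prems(1) regs \<open>v \<le> w\<close> s2(1)] .
  then show ?case
    using Suc.IH[OF _ s2(2)] by auto
qed auto

lemma wp_append: "wp w (is @ js) B R m = wp w is (wp w js B) R m"
  by (induction w "is" B R m rule: wp.induct) (simp_all add: fun_upd_def)

lemma wp_mono:
  "wp w is A R m \<Longrightarrow> (\<And>R m. A R m \<Longrightarrow> B R m) \<Longrightarrow> wp w is B R m"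
  by (induction w "is" A R m rule: wp.induct) (simp_all add: fun_upd_def)

section \<open>Rewriting the encoding\<close>

definition memory_of :: "int list \<Rightarrow> nat \<Rightarrow> int" where
  "memory_of xs = (\<lambda>i. if i < length xs then xs ! i else 0)"

lemma memory_of_snoc: "(memory_of xs)(length xs := x) = memory_of (xs @ [x])"
  by (auto simp: memory_of_def nth_append)

text \<open>
  The input \<open>ws\<close> stays in place, \<open>rest\<close> is its unread part, and \<open>out\<close> has been written behind it.
  From \<open>z\<close> on, the registers are: the modulus \<open>M\<close>, the read and the write pointer, the constants
  \<open>1\<close> and \<open>0\<close>, a temporary, the number of rows of the current table, and the number of rows done.
\<close>

definition copying ::
    "nat \<Rightarrow> int \<Rightarrow> int list \<Rightarrow> int \<Rightarrow> int \<Rightarrow> int list \<Rightarrow> int list \<Rightarrow> assertion" where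
  "copying z M ws cnt j rest out R m \<longleftrightarrow>
     (\<forall>r<z. R r = (if r = 0 then int (length ws) else 0)) \<and> m = memory_of (ws @ out) \<and>
     R z = M \<and> (\<exists>pref. ws = pref @ rest \<and> R (z + 1) = int (length pref)) \<and>
     R (z + 2) = int (length (ws @ out)) \<and> R (z + 3) = 1 \<and> R (z + 4) = 0 \<and>
     R (z + 6) = cnt \<and> R (z + 7) = j"

definition copy :: "nat \<Rightarrow> instr list" where
  "copy z = [Load (z + 5) (z + 1), Store (z + 2) (z + 5),
     Arith Plus (z + 1) (z + 1) (z + 3), Arith Plus (z + 2) (z + 2) (z + 3)]"

definition emit :: "nat \<Rightarrow> nat \<Rightarrow> instr list" where
  "emit z r = [Store (z + 2) r, Arith Plus (z + 2) (z + 2) (z + 3)]"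

lemma words_nonneg: "0 \<le> x \<Longrightarrow> x < 2 ^ w \<Longrightarrow> x \<in> words w"
  by (auto simp: words_def intro: order.trans[of _ 0])

lemma words_of_nat: "n < 2 ^ w \<Longrightarrow> int n \<in> words w"
  using of_nat_less_iff[of n "2 ^ w", where 'a = int] by (intro words_nonneg) simp_all

lemma words_Suc_of_nat: "Suc n < 2 ^ w \<Longrightarrow> int n + 1 \<in> words w"
  using words_of_nat[of "Suc n" w] by (simp add: add.commute)

lemma copying_load:
  assumes "copying z M ws cnt j (x # rest) out R m" and "set ws \<subseteq> words w"
  shows "0 \<le> R (Suc z)" and "m (nat (R (Suc z))) = x" and "x \<in> words w"
  using assms by (auto simp: copying_def memory_of_def nth_append)

lemma wp_copy:
  assumes C: "copying z M ws cnt j (x # rest) out R m" and W: "set ws \<subseteq> words w"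
    and len: "length ws + length out + 1 < 2 ^ w"
  shows "wp w (copy z) (copying z M ws cnt j rest (out @ [x])) R m"
proof -
  obtain pref where pref: "ws = pref @ x # rest" "R (z + 1) = int (length pref)"
    using C by (auto simp: copying_def)
  have m: "m = memory_of (ws @ out)" and wpt: "nat (R (z + 2)) = length (ws @ out)"
    using C by (simp_all add: copying_def del: length_append)
  have "int (length pref) + 1 \<in> words w" "int (length (ws @ out)) + 1 \<in> words w"
    using len pref(1) by (intro words_Suc_of_nat; simp)+
  moreover have "ws = (pref @ [x]) @ rest"
    using pref by simp
  moreover have "m(nat (R (z + 2)) := x) = memory_of (ws @ out @ [x])"
    using memory_of_snoc[of "ws @ out" x] m wpt by simp
  ultimately show ?thesis
    using C pref copying_load[OF C W]
    by (auto simp: copy_def copying_def add.commute[of 1] intro!: exI[of _ "pref @ [x]"])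
qed

lemma wp_emit:
  assumes C: "copying z M ws cnt j rest out R m"
    and len: "length ws + length out + 1 < 2 ^ w"
    and r: "r \<noteq> z + 2" "R r = x"
  shows "wp w (emit z r) (copying z M ws cnt j rest (out @ [x])) R m"
proof -
  have m: "m = memory_of (ws @ out)" and wpt: "nat (R (z + 2)) = length (ws @ out)"
    using C by (simp_all add: copying_def del: length_append)
  have "int (length (ws @ out)) + 1 \<in> words w"
    using len by (intro words_Suc_of_nat) simp
  moreover have "m(nat (R (z + 2)) := x) = memory_of (ws @ out @ [x])"
    using memory_of_snoc[of "ws @ out" x] m wpt by simp
  ultimately show ?thesis
    using C r by (auto simp: emit_def copying_def add.commute[of 1])
qed

section \<open>Copying rows and tables\<close>

lemma wp_copies:
  assumes "copying z M ws cnt j (xs @ rest) out R m" and "set ws \<subseteq> words w"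
    and "length ws + length out + length xs < 2 ^ w"
  shows "wp w (concat (replicate (length xs) (copy z))) (copying z M ws cnt j rest (out @ xs)) R m"
  using assms
proof (induction xs arbitrary: out R m)
  case (Cons x xs)
  have "wp w (copy z) (copying z M ws cnt j (xs @ rest) (out @ [x])) R m"
    using Cons.prems by (intro wp_copy) auto
  then show ?case
    using Cons.IH[of "out @ [x]"] Cons.prems
    by (auto simp: wp_append elim!: wp_mono)
qed simp

text \<open>The arity \<open>k\<close> is fixed by the query, so the row is copied by unrolled code.
  Register \<open>z + 3\<close> supplies the value \<open>1\<close> that the listed tuple gets in
  the new table.\<close>

definition copy_row :: "nat \<Rightarrow> nat \<Rightarrow> instr list" where
  "copy_row z k = concat (replicate k (copy z)) @ emit z (z + 3) @ [Arith Plus (z + 7) (z + 7) (z + 3)]"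

lemma length_copy_row [simp]: "length (copy_row z k) = 4 * k + 3"
  by (simp add: copy_row_def length_concat sum_list_replicate copy_def emit_def)

lemma wp_copy_row:
  assumes "copying z M ws cnt j (xs @ rest) out R m" and "set ws \<subseteq> words w"
    and "length ws + length out + length xs + 1 < 2 ^ w" and "j + 1 \<in> words w"
  shows "wp w (copy_row z (length xs)) (copying z M ws cnt (j + 1) rest (out @ xs @ [1])) R m"
proof -
  have "wp w (emit z (z + 3) @ [Arith Plus (z + 7) (z + 7) (z + 3)])
      (copying z M ws cnt (j + 1) rest (out @ xs @ [1])) R' m'"
    if C: "copying z M ws cnt j rest (out @ xs) R' m'" for R' m'
  proof -
    have "wp w (emit z (z + 3)) (copying z M ws cnt j rest ((out @ xs) @ [1])) R' m'"
      using C assms by (intro wp_emit) (auto simp: copying_def)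
    then show ?thesis
      unfolding wp_append
      by (rule wp_mono) (use assms(4) in \<open>auto simp: copying_def\<close>)
  qed
  then show ?thesis
    unfolding copy_row_def wp_append[of w "concat _"]
    using wp_copies[OF assms(1,2)] assms(3) by (auto elim!: wp_mono)
qed

text \<open>The row count is loaded as the loop bound and also copied to the output. For a negative
  factor, \<open>M\<close> follows it as default constant, as \<open>encode_spq_db\<close>
  demands.\<close>

definition copy_table :: "nat \<Rightarrow> bool \<Rightarrow> nat \<Rightarrow> com" where
  "copy_table z neg k = Seq
     (Block ([Load (z + 6) (z + 1), Const (z + 7) 0] @ copy z @ (if neg then emit z z else [])))
     (While (z + 7) (z + 6) (Block (copy_row z k)))"

definition between_tables :: "nat \<Rightarrow> int \<Rightarrow> int list \<Rightarrow> int list \<Rightarrow> int list \<Rightarrow> assertion" where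
  "between_tables z M ws rest out R m \<longleftrightarrow> (\<exists>cnt j. copying z M ws cnt j rest out R m)"

lemma hoare_copy_rows:
  assumes W: "set ws \<subseteq> words w" and rows: "\<And>r. r \<in> set rows \<Longrightarrow> length r = k"
    and cnt: "int (length rows) \<in> words w"
    and len: "length ws + length out + length (concat (map (\<lambda>r. r @ [1]) rows)) < 2 ^ w"
  shows "hoare w (copying z M ws (int (length rows)) 0 (concat rows @ rest) out)
    (While (z + 7) (z + 6) (Block (copy_row z k))) (length rows * (4 * k + 5) + 1)
    (between_tables z M ws rest (out @ concat (map (\<lambda>r. r @ [1]) rows)))"
proof -
  define I where "I i = copying z M ws (int (length rows)) (int i) (concat (drop i rows) @ rest)
    (out @ concat (map (\<lambda>r. r @ [1]) (take i rows)))" for i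
  have "hoare w (I 0) (While (z + 7) (z + 6) (Block (copy_row z k)))
    (length rows * ((4 * k + 3) + 2) + 1) (I (length rows))"
  proof (rule hoare_While)
    fix i assume i: "i < length rows"
    have drop: "concat (drop i rows) = rows ! i @ concat (drop (Suc i) rows)"
      using i by (metis Cons_nth_drop_Suc concat.simps(2))
    have take: "concat (map (\<lambda>r. r @ [1]) (take (Suc i) rows)) =
        concat (map (\<lambda>r. r @ [1]) (take i rows)) @ rows ! i @ [1]"
      using i by (simp add: take_Suc_conv_app_nth)
    have "length (concat (map (\<lambda>r. r @ [1]) (take (Suc i) rows))) \<le>
        length (concat (map (\<lambda>r. r @ [1]) rows))"
      by (metis (no_types, lifting) append_take_drop_id concat_append le_add1 length_append map_append)
    then have len': "length ws + length (out @ concat (map (\<lambda>r. r @ [1]) (take i rows))) +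
        length (rows ! i) + 1 < 2 ^ w"
      using len take by simp
    \<comment> \<open>The row counter never exceeds the row count, which is a word.\<close>
    have "int i + 1 \<in> words w"
      using cnt i by (intro words_Suc_of_nat) (simp add: words_def)
    then show "hoare w (I i) (Block (copy_row z k)) (4 * k + 3) (I (Suc i))"
      using wp_copy_row[OF _ W len', of z M "int (length rows)" "int i"
          "concat (drop (Suc i) rows) @ rest"] rows[of "rows ! i"] i
      by (intro hoare_Block) (simp_all add: I_def drop take add.commute[of 1])
  next
    fix i R m
    assume "i \<le> length rows" "I i R m"
    then show "R (z + 7) < R (z + 6) \<longleftrightarrow> i < length rows"
      by (simp add: I_def copying_def)
  qed
  then show ?thesis
    by (rule hoare_conseq) (auto simp: I_def between_tables_def)
qed

text \<open>The bound is a constant times \<open>length rows + 1\<close>, the form in which times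
  are summed over the tables; the \<open>1\<close> pays for the fixed work on a table, even an empty
  one.\<close>

lemma hoare_copy_table:
  assumes W: "set ws \<subseteq> words w" and rows: "\<And>r. r \<in> set rows \<Longrightarrow> length r = k"
    and len: "length ws + length out +
      length (int (length rows) # (if neg then [M] else []) @ concat (map (\<lambda>r. r @ [1]) rows)) < 2 ^ w"
  shows "hoare w (between_tables z M ws (int (length rows) # concat rows @ rest) out)
    (copy_table z neg k) ((4 * k + 10) * (length rows + 1))
    (between_tables z M ws rest
      (out @ int (length rows) # (if neg then [M] else []) @ concat (map (\<lambda>r. r @ [1]) rows)))"
proof (cases "int (length rows) \<in> set ws")
  \<comment> \<open>The precondition makes the row count an entry of \<open>ws\<close>, so here it
    is unsatisfiable and the triple holds vacuously. In the other case the row count is a word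
    because it is an input word.\<close>
  case False
  then have "\<not> between_tables z M ws (int (length rows) # concat rows @ rest) out R m" for R m
    unfolding between_tables_def copying_def by force
  then show ?thesis
    by (simp add: hoare_def)
next
  case True
  then have cnt: "int (length rows) \<in> words w"
    using W by blast
  let ?n = "int (length rows)"
  let ?out = "out @ ?n # (if neg then [M] else [])"
  have "hoare w (between_tables z M ws (?n # concat rows @ rest) out)
    (Block ([Load (z + 6) (z + 1), Const (z + 7) 0] @ copy z @ (if neg then emit z z else []))) 8
    (copying z M ws ?n 0 (concat rows @ rest) ?out)"
  proof (rule hoare_Block)
    fix R m
    assume "between_tables z M ws (?n # concat rows @ rest) out R m"
    then obtain c j where C: "copying z M ws c j (?n # concat rows @ rest) out R m"
      by (auto simp: between_tables_def)
    have C': "copying z M ws ?n 0 (?n # concat rows @ rest) out (R(z + 6 := ?n, z + 7 := 0)) m"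
      using C by (simp add: copying_def)
    have "wp w (copy z) (copying z M ws ?n 0 (concat rows @ rest) (out @ [?n]))
        (R(z + 6 := ?n, z + 7 := 0)) m"
      by (rule wp_copy[OF C' W]) (use len in simp)
    then have "wp w (copy z @ (if neg then emit z z else []))
        (copying z M ws ?n 0 (concat rows @ rest) ?out) (R(z + 6 := ?n, z + 7 := 0)) m"
      unfolding wp_append
    proof (rule wp_mono)
      fix R m
      assume A: "copying z M ws ?n 0 (concat rows @ rest) (out @ [?n]) R m"
      then have "R z = M"
        by (simp add: copying_def)
      then have "neg \<Longrightarrow> wp w (emit z z)
          (copying z M ws ?n 0 (concat rows @ rest) ((out @ [?n]) @ [M])) R m"
        using len by (intro wp_emit[OF A]) simp_all
      then show "wp w (if neg then emit z z else [])
          (copying z M ws ?n 0 (concat rows @ rest) ?out) R m"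
        using A by simp
    qed
    moreover have "0 \<in> words w"
      by (simp add: words_def)
    ultimately show "wp w ([Load (z + 6) (z + 1), Const (z + 7) 0] @ copy z @
        (if neg then emit z z else [])) (copying z M ws ?n 0 (concat rows @ rest) ?out) R m"
      using copying_load[OF C W] by simp
  qed (simp add: copy_def emit_def)
  moreover have "hoare w (copying z M ws ?n 0 (concat rows @ rest) ?out)
    (While (z + 7) (z + 6) (Block (copy_row z k))) (length rows * (4 * k + 5) + 1)
    (between_tables z M ws rest (?out @ concat (map (\<lambda>r. r @ [1]) rows)))"
    using len by (intro hoare_copy_rows W rows cnt) simp_all
  ultimately have "hoare w (between_tables z M ws (?n # concat rows @ rest) out)
    (copy_table z neg k) (8 + (length rows * (4 * k + 5) + 1))
    (between_tables z M ws rest (?out @ concat (map (\<lambda>r. r @ [1]) rows)))"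
    unfolding copy_table_def by (rule hoare_Seq)
  then show ?thesis
    by (rule hoare_conseq) (simp_all add: algebra_simps)
qed

text \<open>\<open>[0, 1]\<close> encodes an empty table with default constant \<open>1\<close>,
  that is, the factor that is constantly \<open>1\<close>. No input is consumed.\<close>

lemma hoare_emit_neutral:
  assumes "length ws + length out + 2 < 2 ^ w"
  shows "hoare w (between_tables z M ws rest out) (Block (emit z (z + 4) @ emit z (z + 3))) 4
    (between_tables z M ws rest (out @ [0, 1]))"
proof (rule hoare_Block)
  fix R m
  assume "between_tables z M ws rest out R m"
  then obtain c j where C: "copying z M ws c j rest out R m"
    by (auto simp: between_tables_def)
  have "wp w (emit z (z + 4)) (copying z M ws c j rest (out @ [0])) R m"
    using C assms by (intro wp_emit) (auto simp: copying_def)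
  then show "wp w (emit z (z + 4) @ emit z (z + 3)) (between_tables z M ws rest (out @ [0, 1])) R m"
    unfolding wp_append
  proof (rule wp_mono)
    fix R m
    assume "copying z M ws c j rest (out @ [0]) R m"
    then have "wp w (emit z (z + 3)) (copying z M ws c j rest ((out @ [0]) @ [1])) R m"
      using assms by (intro wp_emit) (auto simp: copying_def)
    then show "wp w (emit z (z + 3)) (between_tables z M ws rest (out @ [0, 1])) R m"
      by (rule wp_mono) (auto simp: between_tables_def)
  qed
qed (simp add: emit_def)

text \<open>The number of tables is fixed by the query, so their programs are simply put in
  sequence. The bound on the total output covers each intermediate stage, since the output only
  grows.\<close>

lemma hoare_tables:
  assumes "\<And>j rest out. j \<in> set js \<Longrightarrow> length ws + length out + length (outp j) < 2 ^ w \<Longrightarrow>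
      hoare w (between_tables z M ws (inp j @ rest) out) (f j) (T j)
        (between_tables z M ws rest (out @ outp j))"
    and "length ws + length out + length (concat (map outp js)) < 2 ^ w"
  shows "hoare w (between_tables z M ws (concat (map inp js) @ rest) out)
    (foldr Seq (map f js) (Block [])) (sum_list (map T js))
    (between_tables z M ws rest (out @ concat (map outp js)))"
  using assms
proof (induction js arbitrary: out)
  case Nil
  show ?case
    by (simp add: hoare_Block)
next
  case (Cons j js)
  have "hoare w (between_tables z M ws (inp j @ concat (map inp js) @ rest) out) (f j) (T j)
        (between_tables z M ws (concat (map inp js) @ rest) (out @ outp j))"
    using Cons.prems by simp
  moreover have "hoare w (between_tables z M ws (concat (map inp js) @ rest) (out @ outp j))
      (foldr Seq (map f js) (Block [])) (sum_list (map T js))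
      (between_tables z M ws rest ((out @ outp j) @ concat (map outp js)))"
    using Cons.prems by (intro Cons.IH) auto
  ultimately show ?case
    using hoare_Seq by fastforce
qed

section \<open>The modulus and the initial pointers\<close>

definition prepare :: "nat \<Rightarrow> nat \<Rightarrow> com" where
  "prepare z e = Block ([Const (z + 3) 1, Const (z + 4) 0, Const (z + 5) 2,
     Arith Plus (z + 8) 0 (z + 5), Const z 1] @ replicate e (Arith Times z z (z + 8)) @
     [Const (z + 1) 0, Arith Plus (z + 2) 0 (z + 4)])"

lemma wp_power:
  assumes "\<And>i. i \<le> e \<Longrightarrow> R a * R b ^ i \<in> words w" and "a \<noteq> b" and "B (R(a := R a * R b ^ e)) m"
  shows "wp w (replicate e (Arith Times a a b)) B R m"
  using assms
proof (induction e arbitrary: R)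
  case (Suc e)
  have "R a * R b * R b ^ i \<in> words w" if "i \<le> e" for i
    using Suc.prems(1)[of "Suc i"] that by (simp add: mult.assoc)
  moreover have "R a * R b \<in> words w"
    using Suc.prems(1)[of 1] by simp
  moreover have "wp w (replicate e (Arith Times a a b)) B (R(a := R a * R b)) m"
    by (rule Suc.IH) (use calculation Suc.prems(2,3) in \<open>simp_all add: mult.assoc cong: if_cong\<close>)
  ultimately show ?case
    by simp
qed simp

text \<open>Register \<open>z + 8\<close> receives the base \<open>length ws + 2\<close>, and
  \<open>z\<close> accumulates its powers from \<open>1\<close>. Adding the zero in
  \<open>z + 4\<close> to register \<open>0\<close> moves the input length into the write pointer,
  so writing starts just behind the input.\<close>

lemma hoare_prepare:
  assumes "0 < z" and "0 < e" and M: "M = (int (length ws) + 2) ^ e" "M < 2 ^ w"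
  shows "hoare w (\<lambda>R m. (\<forall>r<z. R r = (if r = 0 then int (length ws) else 0)) \<and> m = memory_of ws)
    (prepare z e) (e + 7) (between_tables z M ws ws [])"
  unfolding prepare_def
proof (rule hoare_Block)
  fix R m
  assume A: "(\<forall>r<z. R r = (if r = 0 then int (length ws) else 0)) \<and> m = memory_of ws"
  let ?L = "int (length ws)"
  \<comment> \<open>\<open>M\<close> is the largest of the powers and, as \<open>0 < e\<close>, at
    least the base, so \<open>M < 2 ^ w\<close> rules out every overflow.\<close>
  have pow: "(?L + 2) ^ i \<le> M" if "i \<le> e" for i
    unfolding M(1) by (rule power_increasing[OF that]) simp
  have le: "?L + 2 \<le> M"
    using pow[of 1] \<open>0 < e\<close> by simp
  have small: "x \<in> words w" if "0 \<le> x" "x \<le> ?L + 2" for x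
    using that le M(2) by (intro words_nonneg) auto
  have pw: "(?L + 2) ^ i \<in> words w" if "i \<le> e" for i
    using pow[OF that] M(2) by (intro words_nonneg) auto
  have R0: "R 0 = ?L"
    using A \<open>0 < z\<close> by simp
  show "wp w ([Const (z + 3) 1, Const (z + 4) 0, Const (z + 5) 2,
     Arith Plus (z + 8) 0 (z + 5), Const z 1] @ replicate e (Arith Times z z (z + 8)) @
     [Const (z + 1) 0, Arith Plus (z + 2) 0 (z + 4)]) (between_tables z M ws ws []) R m"
    using A \<open>0 < z\<close>
    by (auto simp: wp_append R0 small pw M(1) between_tables_def copying_def intro!: wp_power)
qed simp

section \<open>Moving the new encoding to address 0\<close>

definition shift_down :: "nat \<Rightarrow> com" where
  "shift_down z = Seq (Block [Const (z + 7) 0]) (Seq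
     (While (z + 7) (z + 2) (Block [Arith Plus (z + 5) (z + 7) 0, Load (z + 5) (z + 5),
        Store (z + 7) (z + 5), Arith Plus (z + 7) (z + 7) (z + 3)]))
     (Block [Arith Minus 0 (z + 2) 0]))"

text \<open>Cell \<open>i\<close> receives the content of cell \<open>i + length ws\<close>, in
  increasing order, so the cells still to be read are intact. The loop runs up to the old write
  pointer and thus beyond the end of \<open>out\<close>, so that zeros from behind the data erase
  the leftovers. Register \<open>0\<close> still holds \<open>length ws\<close>; subtracting it from
  the write pointer leaves the length of \<open>out\<close>.\<close>

lemma hoare_shift_down:
  assumes "0 < z" and W: "set ws \<subseteq> words w" "set out \<subseteq> words w"
    and len: "2 * length ws + length out < 2 ^ w"
  shows "hoare w (between_tables z M ws [] out) (shift_down z) (6 * (length ws + length out) + 3)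
    (\<lambda>R m. (\<forall>r<z. R r = (if r = 0 then int (length out) else 0)) \<and> m = memory_of out \<and> R z = M)"
proof -
  let ?L = "length ws" and ?N = "length (ws @ out)"
  define I where "I i R m \<longleftrightarrow> (\<forall>r<z. R r = (if r = 0 then int ?L else 0)) \<and>
    m = (\<lambda>j. memory_of (ws @ out) (if j < i then j + ?L else j)) \<and>
    R z = M \<and> R (z + 2) = int ?N \<and> R (z + 3) = 1 \<and> R (z + 7) = int i" for i :: nat and R m
  have mem_words: "memory_of (ws @ out) i \<in> words w" for i
    using W nth_mem[of i "ws @ out"] words_of_nat[of 0 w] by (auto simp: memory_of_def)
  have "hoare w (between_tables z M ws [] out) (Block [Const (z + 7) 0]) 1 (I 0)"
    by (rule hoare_Block) (auto simp: I_def between_tables_def copying_def words_def)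
  moreover have "hoare w (I 0) (While (z + 7) (z + 2) (Block [Arith Plus (z + 5) (z + 7) 0,
      Load (z + 5) (z + 5), Store (z + 7) (z + 5), Arith Plus (z + 7) (z + 7) (z + 3)]))
      (?N * (4 + 2) + 1) (I ?N)"
  proof (rule hoare_While)
    fix i assume i: "i < ?N"
    \<comment> \<open>The read address is \<open>i\<close> plus the input length, with
      \<open>i\<close> already ranging over both lists; hence \<open>len\<close> counts
      \<open>ws\<close> twice.\<close>
    have "int (i + ?L) \<in> words w"
      using i len by (intro words_of_nat) simp
    moreover have "int i + 1 \<in> words w"
      using i len by (intro words_Suc_of_nat) simp
    moreover have "(\<lambda>j. memory_of (ws @ out) (if j < i then j + ?L else j))(i := memory_of (ws @ out) (i + ?L)) =
        (\<lambda>j. memory_of (ws @ out) (if j < Suc i then j + ?L else j))"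
      by (auto simp: less_Suc_eq)
    moreover have "nat (int i + int ?L) = i + ?L"
      by simp
    ultimately show "hoare w (I i) (Block [Arith Plus (z + 5) (z + 7) 0,
      Load (z + 5) (z + 5), Store (z + 7) (z + 5), Arith Plus (z + 7) (z + 7) (z + 3)]) 4 (I (Suc i))"
      using \<open>0 < z\<close> mem_words
      by (intro hoare_Block) (auto simp: I_def add.commute[of 1])
  next
    fix i R m
    assume "i \<le> ?N" "I i R m"
    then show "R (z + 7) < R (z + 2) \<longleftrightarrow> i < ?N"
      by (simp add: I_def flip: of_nat_add)
  qed
  moreover have "hoare w (I ?N) (Block [Arith Minus 0 (z + 2) 0]) 1
    (\<lambda>R m. (\<forall>r<z. R r = (if r = 0 then int (length out) else 0)) \<and> m = memory_of out \<and> R z = M)"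
  proof (rule hoare_Block)
    fix R m
    assume "I ?N R m"
    moreover have "int (length out) \<in> words w"
      using len by (intro words_of_nat) simp
    moreover have "(\<lambda>j. memory_of (ws @ out) (if j < ?N then j + ?L else j)) = memory_of out"
      by (auto simp: memory_of_def nth_append)
    ultimately show "wp w [Arith Minus 0 (z + 2) 0]
      (\<lambda>R m. (\<forall>r<z. R r = (if r = 0 then int (length out) else 0)) \<and> m = memory_of out \<and> R z = M) R m"
      using \<open>0 < z\<close> by (auto simp: I_def)
  qed simp
  ultimately have "hoare w (between_tables z M ws [] out) (shift_down z) (1 + (?N * (4 + 2) + 1 + 1))
    (\<lambda>R m. (\<forall>r<z. R r = (if r = 0 then int (length out) else 0)) \<and> m = memory_of out \<and> R z = M)"
    unfolding shift_down_def by (intro hoare_Seq)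
  then show ?thesis
    by (rule hoare_conseq) auto
qed

text \<open>To the relocated \<open>P\<close>, the state after the prologue looks like
  \<open>initial out\<close>. Its halting positions all lead to the final instruction, which reduces
  the output modulo the \<open>M\<close> kept in register \<open>z\<close>.\<close>

lemma program_computes:
  assumes c: "hoare w (\<lambda>R m. (\<forall>r<z. R r = (if r = 0 then int (length ws) else 0)) \<and> m = memory_of ws) c T
      (\<lambda>R m. (\<forall>r<z. R r = (if r = 0 then int (length out) else 0)) \<and> m = memory_of out \<and> R z = M)"
    and "0 < z" and regs: "\<And>i. i \<in> set P \<Longrightarrow> instr_regs i \<subseteq> {..<z}"
    and "v \<le> w" and P: "computes_in v P out t x" and M: "0 < M" "M < 2 ^ w"
  shows "\<exists>t'\<le>T + t + 1. computes_in w
    (compile 0 c @ map (relocate (csize c) (length P)) P @ [Arith Modulo 0 0 z]) ws t' (x mod M)"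
proof -
  let ?pre = "compile 0 c" and ?post = "[Arith Modulo 0 0 z]"
  let ?P = "map (relocate (csize c) (length P)) P"
  obtain t1 R m where t1: "t1 \<le> T" "\<forall>r<z. R r = (if r = 0 then int (length out) else 0)"
    "m = memory_of out" "R z = M"
    "steps w (?pre @ ?P @ ?post) t1 (initial ws) = Some \<lparr>pc = csize c, reg = R, mem = m\<rparr>"
    using c[unfolded hoare_def, rule_format, of "\<lambda>r. if r = 0 then int (length ws) else 0"
        "memory_of ws" "[]" "?P @ ?post"]
    by (auto simp: initial_def memory_of_def)
  obtain s where s: "steps v P t (initial out) = Some s" "halted P s" "reg s 0 = x"
    using P by (auto simp: computes_in_def)
  have "simulates z (length ?pre) (length P) R (initial out) \<lparr>pc = csize c, reg = R, mem = m\<rparr>"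
    using t1(2,3) by (auto simp: simulates_def initial_def memory_of_def)
  from simulates_steps[OF this regs \<open>v \<le> w\<close> s(1), of ?post] obtain s' where s':
    "steps w (?pre @ ?P @ ?post) t \<lparr>pc = csize c, reg = R, mem = m\<rparr> = Some s'"
    "simulates z (csize c) (length P) R s s'"
    by auto
  have pc: "pc s' = length (?pre @ ?P)" and r: "reg s' 0 = x" "reg s' z = M"
    using s' s(2,3) t1(4) \<open>0 < z\<close> by (auto simp: simulates_def halted_def)
  \<comment> \<open>For positive \<open>M\<close> the residue is non-negative even if
    \<open>x\<close> is negative.\<close>
  have "x mod M \<in> words w"
    using M pos_mod_bound[of M x] pos_mod_sign[of M x] by (intro words_nonneg; linarith)
  then have "steps w (?pre @ ?P @ ?post) 1 s' =
      Some (s'\<lparr>pc := Suc (pc s'), reg := (reg s')(0 := x mod M)\<rparr>)"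
    using pc r by (simp add: step_def halted_def nth_append set_reg_def)
  from steps_trans[OF steps_trans[OF t1(5) s'(1)] this]
  have "computes_in w (?pre @ ?P @ ?post) ws (t1 + t + 1) (x mod M)"
    unfolding computes_in_def using pc by (auto simp: halted_def)
  then show ?thesis
    using t1(1) by (intro exI[of _ "t1 + t + 1"]) simp
qed

section \<open>The reduction\<close>

definition spq_of_cq :: "nat set set \<Rightarrow> int \<Rightarrow> cq_db \<Rightarrow> int spq_db" where
  "spq_of_cq E' M D =
     \<lparr>pos_table = (\<lambda>K. map (\<lambda>t. (t, 1)) (D K)),
      neg_table = (\<lambda>N. if N \<in> E' then map (\<lambda>t. (t, 1)) (D N) else []),
      neg_default = (\<lambda>N. if N \<in> E' then M else 1)\<rparr>"

lemma spq_db_spq_of_cq: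
  assumes "cq_db (Ep \<union> E') D" and "M \<noteq> 0"
  shows "spq_db Ep En (spq_of_cq E' M D)"
  using assms by (auto simp: spq_db_def spq_of_cq_def cq_db_def factor_table_def comp_def)

text \<open>Exact equality of sizes makes word lengths and time bounds carry over. Disjointness of
  \<open>Ep\<close> and \<open>E'\<close> ensures that each table of the conjunctive query serves
  exactly one factor.\<close>

lemma spq_size_spq_of_cq:
  assumes "finite Ep" "finite En" and "E' \<subseteq> En" and "Ep \<inter> E' = {}"
  shows "spq_size Ep En (spq_of_cq E' M D) = cq_size (Ep \<union> E') D"
proof -
  have "(\<Sum>N\<in>En. length (if N \<in> E' then map (\<lambda>t. (t, 1 :: int)) (D N) else [])) = (\<Sum>N\<in>E'. length (D N))"
    using assms by (intro sum.mono_neutral_cong_right) auto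
  then show ?thesis
    using assms finite_subset[of E' En]
    by (simp add: spq_size_def cq_size_def spq_of_cq_def sum.union_disjoint)
qed

section \<open>The count as a residue of the sum-product value\<close>

lemma factor_value_ones: "factor_value d (map (\<lambda>t. (t, 1)) xs) t = (if t \<in> set xs then 1 else d)"
  by (induction xs) (auto simp: factor_value_def)

lemma spq_summand_spq_of_cq:
  assumes "finite Ep" "finite En" and "E' \<subseteq> En"
  shows "spq_summand Ep En (spq_of_cq E' M D) x =
    (if \<forall>K\<in>Ep. tuple_at x K \<in> set (D K)
     then \<Prod>N\<in>E'. if tuple_at x N \<in> set (D N) then 1 else M else 0)"
proof -
  have "(\<Prod>K\<in>Ep. factor_value 0 (pos_table (spq_of_cq E' M D) K) (tuple_at x K)) =
      (\<Prod>K\<in>Ep. if tuple_at x K \<in> set (D K) then 1 else 0)"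
    by (simp add: spq_of_cq_def factor_value_ones)
  also have "\<dots> = (if \<forall>K\<in>Ep. tuple_at x K \<in> set (D K) then 1 else 0)"
    using assms(1) by (auto simp: prod_zero_iff)
  finally have pos: "(\<Prod>K\<in>Ep. factor_value 0 (pos_table (spq_of_cq E' M D) K) (tuple_at x K)) =
      (if \<forall>K\<in>Ep. tuple_at x K \<in> set (D K) then 1 else 0)" .
  have "(\<Prod>N\<in>En. factor_value (neg_default (spq_of_cq E' M D) N) (neg_table (spq_of_cq E' M D) N)
        (tuple_at x N)) = (\<Prod>N\<in>E'. if tuple_at x N \<in> set (D N) then 1 else M)"
    using assms(2,3)
    by (intro prod.mono_neutral_cong_right)
       (auto simp: spq_of_cq_def factor_value_ones, simp_all add: factor_value_def)
  then show ?thesis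
    by (simp add: spq_summand_def pos)
qed

text \<open>By safety, a valuation is determined by its tuples in the positive tables.\<close>

lemma valuations_in_tables:
  assumes "\<Union>Ep = {1..n}"
  shows "finite {x \<in> valuations n. \<forall>K\<in>Ep. tuple_at x K \<in> set (D K)}" (is "finite ?S")
    and "card {x \<in> valuations n. \<forall>K\<in>Ep. tuple_at x K \<in> set (D K)} \<le> (\<Prod>K\<in>Ep. length (D K))"
proof -
  have fin: "finite Ep"
    using assms by (metis finite_UnionD finite_atLeastAtMost)
  let ?f = "\<lambda>x. \<lambda>K\<in>Ep. tuple_at x K"
  let ?T = "Pi\<^sub>E Ep (\<lambda>K. set (D K))"
  have "inj_on ?f ?S"
  proof (rule inj_onI)
    fix x y
    assume x: "x \<in> ?S" and y: "y \<in> ?S" and eq: "?f x = ?f y"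
    have "x i = y i" if "i \<in> {1..n}" for i
    proof -
      obtain K where K: "K \<in> Ep" "i \<in> K"
        using \<open>i \<in> {1..n}\<close> assms by blast
      then have "finite K"
        using assms by (metis Sup_upper finite_atLeastAtMost finite_subset)
      moreover have "tuple_at x K = tuple_at y K"
        using fun_cong[OF eq, of K] K(1) by simp
      ultimately show ?thesis
        using K(2) by (auto simp: tuple_at_def)
    qed
    then show "x = y"
      using x y PiE_ext[of x "{1..n}" "\<lambda>_. UNIV" y] by (auto simp: valuations_def)
  qed
  moreover have "?f ` ?S \<subseteq> ?T"
    by auto
  moreover have T: "finite ?T"
    using fin by (auto intro: finite_PiE)
  ultimately show "finite ?S"
    using inj_on_finite by blast
  have "card ?S \<le> card ?T"
    using \<open>inj_on ?f ?S\<close> \<open>?f ` ?S \<subseteq> ?T\<close> T by (rule card_inj_on_le)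
  also have "\<dots> \<le> (\<Prod>K\<in>Ep. length (D K))"
    using fin by (auto simp: card_PiE intro!: prod_mono card_length)
  finally show "card ?S \<le> (\<Prod>K\<in>Ep. length (D K))" .
qed

lemma spq_value_mod:
  assumes "\<Union>Ep = {1..n}" and "finite En" and "E' \<subseteq> En"
    and M: "1 < M" "int (\<Prod>K\<in>Ep. length (D K)) < M"
  shows "spq_value n Ep En (spq_of_cq E' M D) mod M = int (cq_count n (Ep \<union> E') D)"
proof -
  have fin: "finite Ep"
    using assms(1) by (metis finite_UnionD finite_atLeastAtMost)
  have fin': "finite E'"
    using assms(2,3) finite_subset by blast
  define S where "S = {x \<in> valuations n. \<forall>K\<in>Ep. tuple_at x K \<in> set (D K)}"
  define g where "g x = (\<Prod>N\<in>E'. if tuple_at x N \<in> set (D N) then 1 else M)" for x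
  have S: "finite S" "int (card S) < M"
    using valuations_in_tables[OF assms(1), of D] M(2)
    unfolding S_def by (blast, meson of_nat_mono order.strict_trans1)
  \<comment> \<open>Powers of \<open>M\<close> never vanish, so the non-zero summands are exactly
    those of the valuations in \<open>S\<close>.\<close>
  have "g x \<noteq> 0" for x
    using fin' M(1) by (auto simp: g_def)
  then have "spq_value n Ep En (spq_of_cq E' M D) = (\<Sum>x\<in>S. g x)"
    unfolding spq_value_def spq_summand_spq_of_cq[OF fin assms(2,3)] S_def g_def[symmetric]
    by (intro sum.cong) auto
  \<comment> \<open>One missing tuple suffices to put a factor \<open>M\<close> into
    \<open>g x\<close>; with none missing, the product is \<open>1\<close>.\<close>
  moreover have "g x mod M = (if \<forall>N\<in>E'. tuple_at x N \<in> set (D N) then 1 else 0)" for x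
  proof (cases "\<forall>N\<in>E'. tuple_at x N \<in> set (D N)")
    case True
    then show ?thesis
      using M(1) by (simp add: g_def)
  next
    case False
    then obtain N where "N \<in> E'" "tuple_at x N \<notin> set (D N)"
      by blast
    then have "M dvd g x"
      unfolding g_def using fin' dvd_prodI[of E' N "\<lambda>N. if tuple_at x N \<in> set (D N) then 1 else M"]
      by simp
    then show ?thesis
      using False by simp
  qed
  then have "(\<Sum>x\<in>S. g x mod M) = int (card {x \<in> S. \<forall>N\<in>E'. tuple_at x N \<in> set (D N)})"
    using S(1) by (simp add: sum.If_cases Int_def)
  moreover have "{x \<in> S. \<forall>N\<in>E'. tuple_at x N \<in> set (D N)} =
      {x \<in> valuations n. \<forall>K\<in>Ep \<union> E'. tuple_at x K \<in> set (D K)}"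
    by (auto simp: S_def)
  \<comment> \<open>The count is thus below \<open>M\<close> and equals its own residue.\<close>
  moreover have "card {x \<in> S. \<forall>N\<in>E'. tuple_at x N \<in> set (D N)} \<le> card S"
    using S(1) by (intro card_mono) auto
  ultimately show ?thesis
    using S(2) mod_sum_eq[of g M S] by (simp add: cq_count_def)
qed

section \<open>Correctness of the rewriting program\<close>

definition reduction :: "nat \<Rightarrow> nat \<Rightarrow> nat set set \<Rightarrow> nat set list \<Rightarrow> nat set list \<Rightarrow> com" where
  "reduction z e E' Ks Ns = Seq (prepare z e) (Seq
     (foldr Seq (map (\<lambda>K. copy_table z False (card K)) Ks) (Block [])) (Seq
     (foldr Seq (map (\<lambda>N. if N \<in> E' then copy_table z True (card N)
        else Block (emit z (z + 4) @ emit z (z + 3))) Ns) (Block []))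
     (shift_down z)))"

lemma encode_rows_ones:
  "encode_rows (map (\<lambda>t. (t, 1)) xs) = concat (map (\<lambda>r. r @ [1]) (map (map int) xs))"
  by (simp add: encode_rows_def comp_def)

lemma concat_map_filter:
  "concat (map f (filter p xs)) = concat (map (\<lambda>x. if p x then f x else []) xs)"
  by (induction xs) auto

text \<open>\<open>filter\<close> keeps the order of \<open>Ns\<close>, so the old and the new
  encoding list their tables in the same order and can be traversed side by side. The tests
  \<open>N \<in> E'\<close> are decided when the program is built.\<close>

lemma hoare_reduction:
  fixes Ks Ns E' D e
  defines "ws \<equiv> encode_cq_db (Ks @ filter (\<lambda>N. N \<in> E') Ns) D"
  defines "M \<equiv> (int (length ws) + 2) ^ e"
  defines "out \<equiv> encode_spq_db Ks Ns (spq_of_cq E' M D)"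
  assumes D: "cq_db (set Ks \<union> E') D"
    and "0 < z" "0 < e" and "M < 2 ^ w" and W: "set ws \<subseteq> words w" "set out \<subseteq> words w"
    and len: "2 * length ws + length out < 2 ^ w"
  shows "hoare w (\<lambda>R m. (\<forall>r<z. R r = (if r = 0 then int (length ws) else 0)) \<and> m = memory_of ws)
    (reduction z e E' Ks Ns)
    ((e + 7) + ((\<Sum>K\<leftarrow>Ks. (4 * card K + 10) * (length (D K) + 1)) +
      ((\<Sum>N\<leftarrow>Ns. if N \<in> E' then (4 * card N + 10) * (length (D N) + 1) else 4) +
       (6 * (length ws + length out) + 3))))
    (\<lambda>R m. (\<forall>r<z. R r = (if r = 0 then int (length out) else 0)) \<and> m = memory_of out \<and> R z = M)"
proof -
  define inp where "inp K = int (length (map (map int) (D K))) # concat (map (map int) (D K))" for K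
  define outp where "outp neg K = int (length (map (map int) (D K))) #
    (if neg then [M] else []) @ concat (map (\<lambda>r. r @ [1]) (map (map int) (D K)))" for neg K
  define inn where "inn N = (if N \<in> E' then inp N else [])" for N
  define outn where "outn N = (if N \<in> E' then outp True N else [0, 1])" for N
  have rows: "length r = card K" if "K \<in> set Ks \<union> E'" "r \<in> set (map (map int) (D K))" for K r
    using D that by (auto simp: cq_db_def)
  \<comment> \<open>The empty lists give \<open>ws\<close> and \<open>out\<close> the shape, with an
    unread rest and an earlier output, in which \<open>hoare_tables\<close> is applied.\<close>
  have ws: "ws = concat (map inp Ks) @ concat (map inn Ns) @ []"
    by (simp add: ws_def encode_cq_db_def inp_def[abs_def] inn_def[abs_def] concat_map_filter cong: if_cong)
  have out: "out = ([] @ concat (map (outp False) Ks)) @ concat (map outn Ns)"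
  proof -
    have "outn N = int (length (neg_table (spq_of_cq E' M D) N)) # neg_default (spq_of_cq E' M D) N #
        encode_rows (neg_table (spq_of_cq E' M D) N)" for N
      by (cases "N \<in> E'")
         (simp_all add: outn_def outp_def spq_of_cq_def encode_rows_ones encode_rows_def[of "[]"])
    then have "outn = (\<lambda>N. int (length (neg_table (spq_of_cq E' M D) N)) #
        neg_default (spq_of_cq E' M D) N # encode_rows (neg_table (spq_of_cq E' M D) N))"
      by blast
    moreover have "outp False = (\<lambda>K. int (length (pos_table (spq_of_cq E' M D) K)) #
        encode_rows (pos_table (spq_of_cq E' M D) K))"
      by (auto simp: outp_def spq_of_cq_def encode_rows_ones)
    ultimately show ?thesis
      by (simp add: out_def encode_spq_db_def)
  qed
  have table: "hoare w (between_tables z M ws (inp K @ rest) out') (copy_table z neg (card K))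
      ((4 * card K + 10) * (length (D K) + 1)) (between_tables z M ws rest (out' @ outp neg K))"
    if "K \<in> set Ks \<union> E'" "length ws + length out' + length (outp neg K) < 2 ^ w" for K rest out' neg
  proof -
    have "hoare w (between_tables z M ws (inp K @ rest) out') (copy_table z neg (card K))
      ((4 * card K + 10) * (length (map (map int) (D K)) + 1))
      (between_tables z M ws rest (out' @ outp neg K))"
      unfolding inp_def outp_def append_Cons
      by (rule hoare_copy_table[OF W(1) rows[OF that(1)]])
         (use that(2) in \<open>simp_all add: outp_def\<close>)
    then show ?thesis
      by simp
  qed
  have 1: "hoare w (\<lambda>R m. (\<forall>r<z. R r = (if r = 0 then int (length ws) else 0)) \<and> m = memory_of ws)
      (prepare z e) (e + 7) (between_tables z M ws ws [])"
    using assms(5-7) by (intro hoare_prepare) (simp_all add: M_def)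
  have 2: "hoare w (between_tables z M ws (concat (map inp Ks) @ concat (map inn Ns) @ []) [])
      (foldr Seq (map (\<lambda>K. copy_table z False (card K)) Ks) (Block []))
      (\<Sum>K\<leftarrow>Ks. (4 * card K + 10) * (length (D K) + 1))
      (between_tables z M ws (concat (map inn Ns) @ []) ([] @ concat (map (outp False) Ks)))"
    by (rule hoare_tables) (use table len out in auto)
  have 3: "hoare w (between_tables z M ws (concat (map inn Ns) @ []) ([] @ concat (map (outp False) Ks)))
      (foldr Seq (map (\<lambda>N. if N \<in> E' then copy_table z True (card N)
        else Block (emit z (z + 4) @ emit z (z + 3))) Ns) (Block []))
      (\<Sum>N\<leftarrow>Ns. if N \<in> E' then (4 * card N + 10) * (length (D N) + 1) else 4)
      (between_tables z M ws [] out)"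
    unfolding out
  proof (rule hoare_tables)
    fix N and rest out' :: "int list"
    assume "length ws + length out' + length (outn N) < 2 ^ w"
    then show "hoare w (between_tables z M ws (inn N @ rest) out')
        (if N \<in> E' then copy_table z True (card N) else Block (emit z (z + 4) @ emit z (z + 3)))
        (if N \<in> E' then (4 * card N + 10) * (length (D N) + 1) else 4)
        (between_tables z M ws rest (out' @ outn N))"
      using table[of N out' True rest] hoare_emit_neutral[of ws out' w z M rest]
      by (auto simp: inn_def outn_def)
  qed (use len out in auto)
  have 4: "hoare w (between_tables z M ws [] out) (shift_down z) (6 * (length ws + length out) + 3)
    (\<lambda>R m. (\<forall>r<z. R r = (if r = 0 then int (length out) else 0)) \<and> m = memory_of out \<and> R z = M)"
    using \<open>0 < z\<close> W len by (rule hoare_shift_down)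
  show ?thesis
    unfolding reduction_def by (intro hoare_Seq[OF 1] hoare_Seq[OF 2[folded ws]] hoare_Seq[OF 3] 4)
qed

section \<open>Linear bounds for the new encoding\<close>

lemma sum_list_le_linear:
  fixes f g :: "'a \<Rightarrow> nat"
  assumes "\<And>x. x \<in> set xs \<Longrightarrow> f x \<le> c * (g x + 1)"
  shows "sum_list (map f xs) \<le> c * (sum_list (map g xs) + length xs)"
  using assms by (induction xs) (force simp: algebra_simps)+

lemma sum_list_filter:
  "sum_list (map f (filter p xs)) = (\<Sum>x\<leftarrow>xs. if p x then f x else (0 :: nat))"
  by (induction xs) auto

text \<open>Arities are at most \<open>n\<close> and the number \<open>q\<close> of factors is
  fixed, so lengths and times are linear in \<open>m\<close>. The bound on single tables serves to
  compare the product of table sizes with \<open>M\<close>, and the last claim serves to bound the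
  word length of the new input.\<close>

lemma reduction_bounds:
  fixes Ks Ns E' D e and n :: nat
  defines "Fs \<equiv> Ks @ filter (\<lambda>N. N \<in> E') Ns"
  defines "ws \<equiv> encode_cq_db Fs D"
  defines "m \<equiv> (\<Sum>K\<leftarrow>Fs. length (D K))" and "q \<equiv> length Ks + length Ns"
  assumes D: "cq_db (set Fs) D" and n: "\<And>K. K \<in> set Fs \<Longrightarrow> card K \<le> n"
  shows "length ws \<le> (n + 1) * (m + q)"
    and "length (encode_spq_db Ks Ns (spq_of_cq E' M D)) \<le> (n + 2) * (m + q)"
    and "(\<Sum>K\<leftarrow>Ks. (4 * card K + 10) * (length (D K) + 1)) +
      (\<Sum>N\<leftarrow>Ns. if N \<in> E' then (4 * card N + 10) * (length (D N) + 1) else 4) \<le> (4 * n + 10) * (m + q)"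
    and "K \<in> set Fs \<Longrightarrow> length (D K) \<le> length ws"
    and "set (encode_spq_db Ks Ns (spq_of_cq E' M D)) \<subseteq> set ws \<union> {0, 1, M}"
proof -
  define enc where "enc K = int (length (D K)) # concat (map (map int) (D K))" for K
  have ws: "ws = concat (map enc Fs)"
    by (simp add: ws_def encode_cq_db_def enc_def[abs_def])
  have m: "m = (\<Sum>K\<leftarrow>Ks. length (D K)) + (\<Sum>N\<leftarrow>Ns. if N \<in> E' then length (D N) else 0)"
    by (simp add: m_def Fs_def sum_list_filter)
  have rows: "length (concat (map (map int) (D K))) = card K * length (D K)" if "K \<in> set Fs" for K
  proof -
    have "map length (D K) = map (\<lambda>_. card K) (D K)"
      using D that by (auto simp: cq_db_def)
    then show ?thesis
      by (simp add: length_concat comp_def sum_list_triv del: map_eq_conv)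
  qed
  have rows': "length (encode_rows (map (\<lambda>t. (t, 1)) (D K))) = (card K + 1) * length (D K)"
    if "K \<in> set Fs" for K
    using rows[OF that] by (simp add: encode_rows_def length_concat comp_def sum_list_Suc)
  have le: "card K * length (D K) \<le> n * length (D K)" if "K \<in> set Fs" for K
    using n[OF that] by simp
  \<comment> \<open>The \<open>2\<close> stands for the row count and the default constant.\<close>
  have table_le: "2 + length (encode_rows (map (\<lambda>t. (t, 1)) (D K))) \<le> (n + 2) * (length (D K) + 1)"
    if "K \<in> set Fs" for K
  proof -
    have "2 + length (encode_rows (map (\<lambda>t. (t, 1)) (D K))) =
        2 + length (D K) + card K * length (D K)"
      using rows'[OF that] by simp
    also have "\<dots> \<le> 2 + length (D K) + n * length (D K)"
      using le[OF that] by simp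
    also have "\<dots> \<le> (n + 2) * (length (D K) + 1)"
      by simp
    finally show ?thesis .
  qed
  have "length ws = (\<Sum>K\<leftarrow>Fs. length (enc K))"
    by (simp add: ws length_concat comp_def)
  also have "\<dots> \<le> (n + 1) * (m + length Fs)"
    unfolding m_def
  proof (rule sum_list_le_linear)
    fix K assume K: "K \<in> set Fs"
    show "length (enc K) \<le> (n + 1) * (length (D K) + 1)"
    proof -
      have "length (enc K) = 1 + card K * length (D K)"
        using rows[OF K] by (simp add: enc_def)
      also have "\<dots> \<le> 1 + n * length (D K)"
        using le[OF K] by simp
      also have "\<dots> \<le> (n + 1) * (length (D K) + 1)"
        by simp
      finally show ?thesis .
    qed
  qed
  also have "\<dots> \<le> (n + 1) * (m + q)"
    by (intro mult_le_mono2) (simp add: Fs_def q_def)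
  finally show "length ws \<le> (n + 1) * (m + q)" .
  have "length (encode_spq_db Ks Ns (spq_of_cq E' M D)) =
      (\<Sum>K\<leftarrow>Ks. 1 + length (encode_rows (map (\<lambda>t. (t, 1)) (D K)))) +
      (\<Sum>N\<leftarrow>Ns. 2 + length (encode_rows (if N \<in> E' then map (\<lambda>t. (t, 1)) (D N) else [])))"
    by (simp add: encode_spq_db_def spq_of_cq_def length_concat comp_def)
  also have "\<dots> \<le> (n + 2) * ((\<Sum>K\<leftarrow>Ks. length (D K)) + length Ks) +
      (n + 2) * ((\<Sum>N\<leftarrow>Ns. if N \<in> E' then length (D N) else 0) + length Ns)"
  proof (intro add_mono sum_list_le_linear)
    fix K assume "K \<in> set Ks"
    then have K: "K \<in> set Fs"
      by (simp add: Fs_def)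
    show "1 + length (encode_rows (map (\<lambda>t. (t, 1)) (D K))) \<le> (n + 2) * (length (D K) + 1)"
      using table_le[OF K] by simp
  next
    fix N assume N: "N \<in> set Ns"
    show "2 + length (encode_rows (if N \<in> E' then map (\<lambda>t. (t, 1)) (D N) else [])) \<le>
        (n + 2) * ((if N \<in> E' then length (D N) else 0) + 1)"
    proof (cases "N \<in> E'")
      case True
      then have "N \<in> set Fs"
        using N by (simp add: Fs_def)
      then show ?thesis
        using True table_le[of N] by simp
    qed (simp add: encode_rows_def)
  qed
  also have "\<dots> = (n + 2) * (m + q)"
    by (simp add: m q_def algebra_simps)
  finally show "length (encode_spq_db Ks Ns (spq_of_cq E' M D)) \<le> (n + 2) * (m + q)" .
  have "(\<Sum>K\<leftarrow>Ks. (4 * card K + 10) * (length (D K) + 1)) +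
      (\<Sum>N\<leftarrow>Ns. if N \<in> E' then (4 * card N + 10) * (length (D N) + 1) else 4) \<le>
    (4 * n + 10) * ((\<Sum>K\<leftarrow>Ks. length (D K)) + length Ks) +
    (4 * n + 10) * ((\<Sum>N\<leftarrow>Ns. if N \<in> E' then length (D N) else 0) + length Ns)"
  proof (intro add_mono sum_list_le_linear)
    fix K assume "K \<in> set Ks"
    then show "(4 * card K + 10) * (length (D K) + 1) \<le> (4 * n + 10) * (length (D K) + 1)"
      using n[of K] by (intro mult_right_mono) (simp_all add: Fs_def)
  next
    fix N assume N: "N \<in> set Ns"
    show "(if N \<in> E' then (4 * card N + 10) * (length (D N) + 1) else 4) \<le>
        (4 * n + 10) * ((if N \<in> E' then length (D N) else 0) + 1)"
    proof (cases "N \<in> E'")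
      case True
      then have "(4 * card N + 10) * (length (D N) + 1) \<le> (4 * n + 10) * (length (D N) + 1)"
        using N n[of N] by (intro mult_right_mono) (simp_all add: Fs_def)
      then show ?thesis
        using True by simp
    qed simp
  qed
  then show "(\<Sum>K\<leftarrow>Ks. (4 * card K + 10) * (length (D K) + 1)) +
      (\<Sum>N\<leftarrow>Ns. if N \<in> E' then (4 * card N + 10) * (length (D N) + 1) else 4) \<le> (4 * n + 10) * (m + q)"
    by (simp add: m q_def algebra_simps)
  show "length (D K) \<le> length ws" if "K \<in> set Fs"
  proof -
    have "length (D K) \<le> 1 + card K * length (D K)"
    proof (cases "card K = 0")
      \<comment> \<open>Rows of arity \<open>0\<close> occupy no words, but distinctness allows at
        most one of them, which the word for the row count pays for.\<close>
      case True
      then have "set (D K) \<subseteq> {[]}" and "distinct (D K)"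
        using D that by (auto simp: cq_db_def)
      then show ?thesis
        using card_mono[of "{[]}" "set (D K)"] by (simp add: distinct_card)
    next
      case False
      then show ?thesis
        by (cases "card K") auto
    qed
    also have "\<dots> = length (enc K)"
      using rows[OF that] by (simp add: enc_def)
    also have "\<dots> \<le> length ws"
      using that by (auto simp: ws length_concat comp_def intro!: member_le_sum_list)
    finally show ?thesis .
  qed
  have "set (enc K) \<subseteq> set ws" if "K \<in> set Fs" for K
    using that by (auto simp: ws)
  moreover have "set (int (length (D K)) # encode_rows (map (\<lambda>t. (t, 1)) (D K))) \<subseteq> set (enc K) \<union> {1}" for K
    by (auto simp: encode_rows_def enc_def)
  ultimately have enc: "set (int (length (D K)) # encode_rows (map (\<lambda>t. (t, 1)) (D K))) \<subseteq> set ws \<union> {1}"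
    if "K \<in> set Fs" for K
    using that by blast
  have "set (int (length (neg_table (spq_of_cq E' M D) N)) # neg_default (spq_of_cq E' M D) N #
      encode_rows (neg_table (spq_of_cq E' M D) N)) \<subseteq> set ws \<union> {0, 1, M}" if "N \<in> set Ns" for N
  proof (cases "N \<in> E'")
    case True
    then show ?thesis
      using enc[of N] that by (auto simp: spq_of_cq_def Fs_def)
  qed (simp add: spq_of_cq_def encode_rows_def)
  moreover have "set (int (length (pos_table (spq_of_cq E' M D) K)) #
      encode_rows (pos_table (spq_of_cq E' M D) K)) \<subseteq> set ws \<union> {0, 1, M}" if "K \<in> set Ks" for K
    using enc[of K] that by (auto simp: spq_of_cq_def Fs_def)
  ultimately show "set (encode_spq_db Ks Ns (spq_of_cq E' M D)) \<subseteq> set ws \<union> {0, 1, M}"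
    unfolding encode_spq_db_def set_append set_concat set_map by blast
qed

text \<open>\<open>2 ^ log_bits m\<close> is at least \<open>m + 2\<close>, and the factor
  \<open>A < 2 ^ A\<close> is absorbed into the exponent because \<open>log_bits m\<close> is
  positive.\<close>

lemma less_two_power_log_bits:
  assumes "x \<le> A * (m + 2)"
  shows "x < 2 ^ ((A + 1) * log_bits m)"
proof -
  have b: "m + 2 \<le> 2 ^ log_bits m"
    unfolding log_bits_def by (rule le_two_power_ceillog2)
  then have pos: "0 < log_bits m"
    by (cases "log_bits m") auto
  have "x \<le> A * 2 ^ log_bits m"
    using assms b by (meson le_trans mult_le_mono2)
  also have "\<dots> < 2 ^ A * 2 ^ log_bits m"
    by (simp add: less_exp)
  also have "\<dots> = 2 ^ (A + log_bits m)"
    by (simp add: power_add)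
  also have "\<dots> \<le> 2 ^ ((A + 1) * log_bits m)"
    using pos by (intro power_increasing) auto
  finally show ?thesis .
qed

text \<open>What remains is to fix the constants. The program \<open>P'\<close> depends only on the
  query and on \<open>P\<close>, while the constants for word length and running time may depend on
  the constant \<open>a\<close> for the input words.\<close>

lemma linear_time_counting_if_int_spq:
  assumes query: "sum_product_query n Ep En" and E': "E' \<subseteq> En" "Ep \<inter> E' = {}"
    and lin: "linear_time_int_spq n Ep En"
  shows "linear_time_counting n (Ep \<union> E')"
proof -
  have fin: "finite Ep" "finite En" and cover: "\<Union>Ep = {1..n}"
    using query by (auto simp: sum_product_query_def intro: finite_subset)
  obtain Ks Ns P where Ks: "distinct Ks" "set Ks = Ep" and Ns: "distinct Ns" "set Ns = En"
    and P: "linear_time_program {D. spq_db Ep En D} (spq_size Ep En) (encode_spq_db Ks Ns)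
          (spq_value n Ep En) P"
    using lin by (auto simp: linear_time_int_spq_def)
  define Fs where "Fs = Ks @ filter (\<lambda>N. N \<in> E') Ns"
  have Fs: "distinct Fs" "set Fs = Ep \<union> E'"
    using Ks Ns E' by (auto simp: Fs_def)
  have card_le: "card K \<le> n" if "K \<in> set Fs" for K
    using that Fs(2) query E'(1) card_mono[of "{1..n}" K] by (auto simp: sum_product_query_def)
  \<comment> \<open>One more than the number of positive tables: a product of \<open>card Ep\<close>
    numbers of size at most \<open>length ws\<close> is then strictly below
    \<open>(length ws + 2) ^ e\<close>.\<close>
  define e where "e = card Ep + 1"
  define q where "q = length Ks + length Ns"
  \<comment> \<open>All registers of \<open>P\<close> and the input and output register
    \<open>0\<close> lie below \<open>z\<close>; those from \<open>z\<close> on are free for the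
    added code.\<close>
  obtain z where z: "0 < z" "\<And>i. i \<in> set P \<Longrightarrow> instr_regs i \<subseteq> {..<z}"
  proof -
    have "finite (\<Union>i\<in>set P. instr_regs i)"
      by simp
    then obtain y where "\<forall>r\<in>\<Union>i\<in>set P. instr_regs i. r < y"
      unfolding finite_nat_set_iff_bounded by blast
    then show thesis
      by (intro that[of "Suc y"]) (auto intro: less_SucI)
  qed
  define P' where "P' = compile 0 (reduction z e E' Ks Ns) @
    map (relocate (csize (reduction z e E' Ks Ns)) (length P)) P @ [Arith Modulo 0 0 z]"
  have "linear_time_program {D. cq_db (Ep \<union> E') D} (cq_size (Ep \<union> E')) (encode_cq_db Fs)
    (\<lambda>D. int (cq_count n (Ep \<union> E') D)) P'"
    unfolding linear_time_program_def
  proof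
    fix a
    \<comment> \<open>The input length plus \<open>2\<close> is at most \<open>A * (m + 2)\<close>,
      so \<open>M\<close> has at most \<open>g * log_bits m\<close> bits. The constant
      \<open>a'\<close> covers the input words, \<open>M\<close>, \<open>0\<close> and
      \<open>1\<close>; it is the one for which \<open>P\<close> provides \<open>k\<close> and
      \<open>c\<close>.\<close>
    define A where "A = (n + 1) * (q + 1) + 1"
    define g where "g = (A + 1) * e"
    define a' where "a' = a + g + 1"
    obtain k c where kc: "\<And>D. spq_db Ep En D \<Longrightarrow>
        set (encode_spq_db Ks Ns D) \<subseteq> words (a' * log_bits (spq_size Ep En D)) \<Longrightarrow>
        \<exists>t\<le>c * (spq_size Ep En D + 1). computes_in (k * log_bits (spq_size Ep En D)) P
          (encode_spq_db Ks Ns D) t (spq_value n Ep En D)"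
      using P unfolding linear_time_program_def by (metis mem_Collect_eq)
    \<comment> \<open>\<open>B\<close> bounds the addresses used while shifting. \<open>k'\<close>
      adds up the needs of \<open>P\<close>, of the words of the new input and of these addresses;
      \<open>c'\<close> adds up the times for fixed work, table copying, shifting and the run of
      \<open>P\<close>.\<close>
    define B where "B = (3 * n + 4) * (q + 1)"
    define k' where "k' = k + a' + B + 1"
    define c' where "c' = e + 11 + (4 * n + 10) * (q + 1) + 6 * ((2 * n + 3) * (q + 1)) + c"
    show "\<exists>k c. \<forall>D\<in>{D. cq_db (Ep \<union> E') D}.
        set (encode_cq_db Fs D) \<subseteq> words (a * log_bits (cq_size (Ep \<union> E') D)) \<longrightarrow>
        (\<exists>t\<le>c * (cq_size (Ep \<union> E') D + 1). computes_in (k * log_bits (cq_size (Ep \<union> E') D)) P'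
          (encode_cq_db Fs D) t (int (cq_count n (Ep \<union> E') D)))"
    proof (rule exI[of _ k'], rule exI[of _ c'], intro ballI impI)
      fix D
      assume "D \<in> {D. cq_db (Ep \<union> E') D}"
      then have D: "cq_db (Ep \<union> E') D"
        by simp
      define m where "m = cq_size (Ep \<union> E') D"
      define b where "b = log_bits m"
      define ws where "ws = encode_cq_db Fs D"
      define M where "M = (int (length ws) + 2) ^ e"
      define out where "out = encode_spq_db Ks Ns (spq_of_cq E' M D)"
      define w where "w = k' * b"
      assume "set (encode_cq_db Fs D) \<subseteq> words (a * log_bits (cq_size (Ep \<union> E') D))"
      then have ws_words: "set ws \<subseteq> words (a * b)"
        by (simp add: ws_def b_def m_def)
      have m: "m = (\<Sum>K\<leftarrow>Fs. length (D K))"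
        using Fs by (metis m_def cq_size_def sum.distinct_set_conv_list)
      have D': "cq_db (set Fs) D"
        using D Fs(2) by simp
      note bounds = reduction_bounds[of Ks E' Ns D n, folded Fs_def, OF D' card_le,
          folded ws_def m q_def]
      have "e > 0"
        by (simp add: e_def)
      have mq: "m + q \<le> (q + 1) * (m + 1)"
        by simp
      have L: "length ws \<le> (n + 1) * (q + 1) * (m + 1)"
        using bounds(1) mq by (metis (no_types, lifting) le_trans mult.assoc mult_le_mono2)
      have L': "length out \<le> (n + 2) * (q + 1) * (m + 1)"
        using bounds(2)[of M] mq unfolding out_def
        by (metis (no_types, lifting) le_trans mult.assoc mult_le_mono2)
      have "length ws + 2 \<le> A * (m + 2)"
        using L by (simp add: A_def algebra_simps)
      then have "length ws + 2 < 2 ^ ((A + 1) * b)"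
        unfolding b_def by (rule less_two_power_log_bits)
      then have "(length ws + 2) ^ e < (2 ^ ((A + 1) * b)) ^ e"
        using \<open>e > 0\<close> by (intro power_strict_mono) auto
      also have "\<dots> = 2 ^ (g * b)"
        by (simp add: g_def algebra_simps flip: power_mult)
      finally have "int ((length ws + 2) ^ e) < int (2 ^ (g * b))"
        by (simp only: of_nat_less_iff)
      then have Mg: "M < 2 ^ (g * b)"
        by (simp add: M_def add.commute)
      have M0: "0 < M"
        by (simp add: M_def)
      have b0: "0 < b"
        using less_two_power_log_bits[of 1 1 m] by (cases b) (auto simp: b_def)
      have mono: "words (i * b) \<subseteq> words (j * b)" if "i \<le> j" for i j
        using that by (intro words_mono) simp
      have small: "{0, 1, M} \<subseteq> words (a' * b)"
      proof -
        have "M \<in> words (a' * b)"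
          using words_nonneg[of M "g * b"] M0 Mg mono[of g a'] by (auto simp: a'_def)
        moreover have "1 < (2 :: nat) ^ (a' * b)"
          using b0 by (intro one_less_power) (simp_all add: a'_def)
        ultimately show ?thesis
          using words_of_nat[of 0] words_of_nat[of 1] by force
      qed
      have out_words: "set out \<subseteq> words (a' * b)"
      proof -
        have "words (a * b) \<subseteq> words (a' * b)"
          by (rule mono) (simp add: a'_def)
        then show ?thesis
          using bounds(5)[of M] ws_words small unfolding out_def by blast
      qed
      have size: "spq_size Ep En (spq_of_cq E' M D) = m"
        unfolding m_def using fin E' by (intro spq_size_spq_of_cq)
      obtain t where t: "t \<le> c * (m + 1)"
        "computes_in (k * b) P out t (spq_value n Ep En (spq_of_cq E' M D))"
      proof -
        have "spq_db Ep En (spq_of_cq E' M D)"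
          using D M0 by (intro spq_db_spq_of_cq) simp_all
        from kc[OF this, unfolded size, folded b_def out_def, OF out_words] show thesis
          using that by blast
      qed
      have "2 * length ws + length out \<le> B * (m + 2)"
        using L L' by (simp add: B_def algebra_simps)
      then have "2 * length ws + length out < 2 ^ ((B + 1) * b)"
        unfolding b_def by (rule less_two_power_log_bits)
      also have "\<dots> \<le> 2 ^ w"
        by (intro power_increasing) (auto simp: w_def k'_def)
      finally have len: "2 * length ws + length out < 2 ^ w" .
      have "(2 :: int) ^ (g * b) \<le> 2 ^ w"
        unfolding w_def by (intro power_increasing mult_le_mono1) (auto simp: k'_def a'_def)
      with Mg have Mw: "M < 2 ^ w"
        by (rule order.strict_trans2)
      have W: "set ws \<subseteq> words w" "set out \<subseteq> words w"
      proof -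
        have "words (a * b) \<subseteq> words w" "words (a' * b) \<subseteq> words w"
          unfolding w_def by (rule mono; simp add: k'_def a'_def)+
        then show "set ws \<subseteq> words w" "set out \<subseteq> words w"
          using ws_words out_words by blast+
      qed
      define T where "T = (e + 7) + ((\<Sum>K\<leftarrow>Ks. (4 * card K + 10) * (length (D K) + 1)) +
        ((\<Sum>N\<leftarrow>Ns. if N \<in> E' then (4 * card N + 10) * (length (D N) + 1) else 4) +
         (6 * (length ws + length out) + 3)))"
      have hoare: "hoare w
        (\<lambda>R m. (\<forall>r<z. R r = (if r = 0 then int (length ws) else 0)) \<and> m = memory_of ws)
        (reduction z e E' Ks Ns) T
        (\<lambda>R m. (\<forall>r<z. R r = (if r = 0 then int (length out) else 0)) \<and> m = memory_of out \<and> R z = M)"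
        unfolding T_def
        by (rule hoare_reduction[where Ks = Ks and Ns = Ns and E' = E' and D = D and e = e,
              folded Fs_def, folded ws_def, folded M_def, folded out_def])
           (use D Ks z \<open>e > 0\<close> Mw W len in auto)
      have "k * b \<le> w"
        unfolding w_def by (rule mult_le_mono1) (simp add: k'_def)
      from program_computes[OF hoare z this t(2) M0 Mw]
      obtain t' where t': "t' \<le> T + t + 1"
        "computes_in w P' ws t' (spq_value n Ep En (spq_of_cq E' M D) mod M)"
        by (auto simp: P'_def)
      have "int (\<Prod>K\<in>Ep. length (D K)) < M" "1 < M"
      proof -
        have "(\<Prod>K\<in>Ep. length (D K)) \<le> (\<Prod>K\<in>Ep. length ws + 2)"
          using bounds(4) Fs(2) by (intro prod_mono conjI trans_le_add1) auto
        also have "\<dots> < (length ws + 2) ^ e"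
          by (simp add: e_def)
        finally have "int (\<Prod>K\<in>Ep. length (D K)) < int ((length ws + 2) ^ e)"
          by (simp only: of_nat_less_iff)
        then show "int (\<Prod>K\<in>Ep. length (D K)) < M"
          by (simp add: M_def add.commute)
        show "1 < M"
          unfolding M_def using \<open>e > 0\<close> by (intro one_less_power) auto
      qed
      then have "spq_value n Ep En (spq_of_cq E' M D) mod M = int (cq_count n (Ep \<union> E') D)"
        using spq_value_mod[OF cover fin(2) E'(1)] by simp
      moreover have "t' \<le> c' * (m + 1)"
      proof -
        \<comment> \<open>Stated for variables, so that the products are atoms of a linear
          inequality. \<open>e + 11\<close> collects \<open>e + 7\<close> for the initialisation,
          \<open>3\<close> from the shift and \<open>1\<close> for the final reduction.\<close>
        have arith: "t' \<le> e + 11 + X' + 6 * Y + Z"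
          if "T \<le> e + 10 + X + 6 * S" "X \<le> X'" "S \<le> Y" "t' \<le> T + t + 1" "t \<le> Z"
          for T t t' X X' S Y Z :: nat
          using that by linarith
        have "T \<le> e + 10 + (4 * n + 10) * (m + q) + 6 * (length ws + length out)"
          using bounds(3) by (simp add: T_def)
        moreover have "(4 * n + 10) * (m + q) \<le> (4 * n + 10) * (q + 1) * (m + 1)"
          using mq by (metis mult.assoc mult_le_mono2)
        moreover have "length ws + length out \<le> (2 * n + 3) * (q + 1) * (m + 1)"
          using L L' by (simp add: algebra_simps)
        ultimately have "t' \<le> (e + 11) + (4 * n + 10) * (q + 1) * (m + 1) +
            6 * ((2 * n + 3) * (q + 1) * (m + 1)) + c * (m + 1)"
          using t'(1) t(1) by (rule arith)
        also have "\<dots> \<le> (e + 11) * (m + 1) + (4 * n + 10) * (q + 1) * (m + 1) +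
            6 * ((2 * n + 3) * (q + 1) * (m + 1)) + c * (m + 1)"
          by simp
        also have "\<dots> = c' * (m + 1)"
          unfolding c'_def by (simp only: distrib_right mult.assoc)
        finally show ?thesis .
      qed
      ultimately show "\<exists>t\<le>c' * (cq_size (Ep \<union> E') D + 1).
          computes_in (k' * log_bits (cq_size (Ep \<union> E') D)) P'
            (encode_cq_db Fs D) t (int (cq_count n (Ep \<union> E') D))"
        using t'(2) by (auto simp: w_def b_def m_def ws_def)
    qed
  qed
  then show ?thesis
    using Fs by (auto simp: linear_time_counting_def)
qed

theorem theorem6p8:
  fixes n :: nat and Ep En :: "nat set set"
  assumes "\<And>m E. conjunctive_query m E \<Longrightarrow> \<not> alpha_acyclic m E \<Longrightarrow> \<not> linear_time_counting m E"
    and "sum_product_query n Ep En"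
    and "\<not> signed_acyclic n Ep En"
  shows "\<not> linear_time_int_spq n Ep En"
proof
  assume lin: "linear_time_int_spq n Ep En"
  obtain E' where "E' \<subseteq> En" and E': "\<not> alpha_acyclic n (Ep \<union> E')"
    using assms(3) by (auto simp: signed_acyclic_def)
  \<comment> \<open>Removing the edges of \<open>Ep\<close> leaves the union unchanged and makes the
    two edge sets disjoint, as the reduction requires.\<close>
  then have sub: "E' - Ep \<subseteq> En" "Ep \<inter> (E' - Ep) = {}"
    by auto
  have "conjunctive_query n (Ep \<union> E')"
    using assms(2) \<open>E' \<subseteq> En\<close> unfolding sum_product_query_def conjunctive_query_def by blast
  moreover have "linear_time_counting n (Ep \<union> E')"
    using linear_time_counting_if_int_spq[OF assms(2) sub lin] by simp
  ultimately show False
    using assms(1) E' by blast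
qed

end
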